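(* Let $Q=\{x+iy:\ |x|<1,\ |y|<1\}\subset\mathbb C$ and let $\nu\in\mathcal A[-1,1]$. Then for each compact set $K\subset Q$ there is a constant $C_K$ such that for every subharmonic function $u$ in $Q$ satisfying $$\int_{-1}^{1}u^+(x+iy)\,d\nu(y)\le 1\qquad\forall x\in(-1,1),$$ one has $u(z)\le C_K$ for all $z\in K$. (The constant $C_K$ is independent of $u$.)
   Context: For a real-valued function $h$, $h^+=\max\{h,0\}$. The class $\mathcal A[a,b]$: let $\nu$ be a probability measure on a segment $[a,b]\subset\mathbb R$, identified with its distribution function $\nu(t)=\nu([a,t])$. Suppose $\nu(t)$ is strictly increasing and continuous on $[a,b]$, and let $\mu$ be its inverse function (defined on $[0,1]$), extended to the whole real axis by $\mu(t)=a$ for $t<0$ and $\mu(t)=b$ for $t>1$. Then $\nu\in\mathcal A[a,b]$ means that $$\lim_{\delta\to0}\ \sup_{x\in\mathbb R}\int_0^\delta\frac{\mu(x+t)-\mu(x-t)}{t}\,dt=0.$$ Such a $\nu$ has no atoms, so the integral over $[-1,1]$ is the same as that over $(-1,1)$. *)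

theory Defs
  imports "HOL-Analysis.Analysis" "HOL-Probability.Probability_Measure"
begin

definition open_square :: "complex set" where
  "open_square = {z. \<bar>Re z\<bar> < 1 \<and> \<bar>Im z\<bar> < 1}"

definition interval_dist_fun :: "real measure \<Rightarrow> real \<Rightarrow> real \<Rightarrow> real" where
  "interval_dist_fun \<nu> a t = measure \<nu> {a..t}"

definition extended_inverse :: "real measure \<Rightarrow> real \<Rightarrow> real \<Rightarrow> real \<Rightarrow> real" where
  "extended_inverse \<nu> a b t =
    (if t < 0 then a else if t > 1 then b
     else the_inv_into {a..b} (interval_dist_fun \<nu> a) t)"

(* The segment [a,b] is non-degenerate. Continuity of t \<mapsto> \<nu>[a,t] on [a,b] does not by
   itself exclude an atom at a; the condition that the distribution function vanishes at a
   does, and it is what makes its inverse defined on all of [0,1].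
   The integrand below is nonnegative because the extended inverse is nondecreasing, so the
   integral and the supremum are taken in [0,\<infinity>]. *)
definition class_A :: "real \<Rightarrow> real \<Rightarrow> real measure set" where
  "class_A a b = {\<nu>. a < b \<and> prob_space \<nu> \<and> sets \<nu> = sets borel \<and> emeasure \<nu> {a..b} = 1
     \<and> interval_dist_fun \<nu> a a = 0
     \<and> strict_mono_on {a..b} (interval_dist_fun \<nu> a)
     \<and> continuous_on {a..b} (interval_dist_fun \<nu> a)
     \<and> ((\<lambda>\<delta>. SUP x. \<integral>\<^sup>+ t \<in> {0<..<\<delta>}.
            ennreal ((extended_inverse \<nu> a b (x + t) - extended_inverse \<nu> a b (x - t)) / t)
            \<partial>lborel) \<longlongrightarrow> 0) (at_right 0)}"

(* The mean over the circle of radius r about z, in [-\<infinity>,\<infinity>], as positive part minus negative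
   part (e2ennreal maps negative numbers to 0). For a function that is upper semicontinuous
   and < \<infinity> on the circle the positive part is finite, so \<infinity> - \<infinity> does not occur. *)
definition circle_mean :: "(complex \<Rightarrow> ereal) \<Rightarrow> complex \<Rightarrow> real \<Rightarrow> ereal" where
  "circle_mean u z r = ereal (1 / (2 * pi)) *
     (enn2ereal (\<integral>\<^sup>+ \<theta> \<in> {0..2 * pi}. e2ennreal (u (z + of_real r * cis \<theta>)) \<partial>lborel)
      - enn2ereal (\<integral>\<^sup>+ \<theta> \<in> {0..2 * pi}. e2ennreal (- u (z + of_real r * cis \<theta>)) \<partial>lborel))"

(* Values in [-\<infinity>,\<infinity>); the constant -\<infinity> is not excluded. *)
definition subharmonic_on :: "(complex \<Rightarrow> ereal) \<Rightarrow> complex set \<Rightarrow> bool" where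
  "subharmonic_on u \<Omega> \<longleftrightarrow> open \<Omega> \<and> (\<forall>z\<in>\<Omega>. u z < \<infinity>)
     \<and> (\<forall>c. openin (top_of_set \<Omega>) {z \<in> \<Omega>. u z < c})
     \<and> (\<forall>z r. r > 0 \<and> cball z r \<subseteq> \<Omega> \<longrightarrow> u z \<le> circle_mean u z r)"

end

theory Submission
  imports Defs "HOL-Complex_Analysis.Complex_Analysis" "HOL-Probability.Distribution_Functions"
begin

text \<open>
  Write \<open>\<mu>\<close> for the inverse of the distribution function of \<open>\<nu>\<close> and \<open>w\<close> for the positive part of \<open>u\<close>.
  The idea is to average \<open>w\<close> over analytic discs whose boundary values have imaginary part distributed
  according to \<open>\<nu>\<close>. Pulled back to such a disc, harmonic measure becomes \<open>d\<nu>(y)\<close> on heights, which is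
  the measure that the hypothesis controls.

  Fix a short interval \<open>[c, c + \<delta>]\<close> inside \<open>(0, 1)\<close>. Let the boundary function on the unit circle climb
  through \<open>\<mu>(c), ..., \<mu>(c + \<delta>)\<close> along the upper half circle and return the same way along the lower half.
  Let \<open>f\<close> be holomorphic in the disc with this boundary function as its imaginary part. The real part of
  \<open>f\<close> is then minus the conjugate function, and since the conjugate Poisson kernel is at most \<open>1/s\<close>, it is
  bounded by \<open>1/\<pi>\<close> times the supremum of the integrals \<open>\<integral>\<^sub>0\<^sup>\<delta> (\<mu>(y + t) - \<mu>(y - t)) / t dt\<close>. The class A
  condition says that this is as small as desired when \<open>\<delta>\<close> is small, so the disc is as thin in the
  horizontal direction as desired (lemma \<open>Im_schwarz_integral_bound\<close>).

  The composition of a subharmonic function with a holomorphic function satisfies the mean value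
  inequality at the centre (lemma \<open>nonneg_subharmonic_holomorphic_disc\<close>). Apply it to all horizontal
  translates of \<open>f\<close> and integrate over the translation. By Tonelli the horizontal displacement of the
  boundary only enlarges the interval of integration in \<open>x\<close>, and the integral over the circle becomes,
  up to the factor \<open>2\<pi>/\<delta>\<close>, an integral with respect to \<open>\<nu>\<close>, which is at most 1. Hence \<open>w\<close> has bounded
  integral over a horizontal segment at the height of the centre (lemma \<open>horizontal_integral_bound\<close>).
  The centre is at the mean height of the boundary function. As \<open>c\<close> varies, these heights
  fill a neighbourhood of any prescribed height, and so \<open>w\<close> has bounded integral over a small square.
  The area mean value inequality gives a pointwise bound near each point of the open square, and
  compactness of \<open>K\<close> finishes the proof.

  The holomorphic function \<open>f\<close> need not extend continuously to the closed disc. Therefore the argument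
  uses \<open>f(r z)\<close> with \<open>r < 1\<close> and lets \<open>r\<close> tend to 1 only after the integration over the translations: then
  convergence of the imaginary parts alone is enough, because the real parts have been absorbed in the
  enlarged interval.
\<close>

section \<open>The Schwarz integral of a continuous function on the circle\<close>

text \<open>Cauchy's formula at the centre, with the angle as parameter.\<close>
lemma holomorphic_circle_mean:
  fixes H :: "complex \<Rightarrow> complex"
  assumes "continuous_on (cball z r) H" "H holomorphic_on ball z r" "0 < r"
  shows "((\<lambda>t. H (z + of_real r * cis t)) has_integral of_real (2 * pi) * H z) {0..2 * pi}"
proof -
  have "((\<lambda>u. H u / (u - z)) has_contour_integral (2 * of_real pi * \<i> * H z)) (circlepath z r)"
    by (rule Cauchy_integral_circlepath) (use assms in auto)
  then have "((\<lambda>u. H u / (u - z)) has_contour_integral (2 * of_real pi * \<i> * H z))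
               (part_circlepath z r 0 (2 * pi))"
    by (simp add: circlepath_def)
  then have 1: "((\<lambda>t. H (z + of_real r * cis t) / (of_real r * cis t) * of_real r * \<i> * cis t)
      has_integral (2 * of_real pi * \<i> * H z)) {0..2 * pi}"
    by (subst (asm) has_contour_integral_part_circlepath_iff) auto
  have 2: "(\<lambda>t. H (z + of_real r * cis t) / (of_real r * cis t) * of_real r * \<i> * cis t)
      = (\<lambda>t. \<i> * H (z + of_real r * cis t))"
    using \<open>0 < r\<close> by (auto simp: fun_eq_iff field_simps)
  have "((\<lambda>t. (-\<i>) * (\<i> * H (z + of_real r * cis t))) has_integral (-\<i>) * (2 * of_real pi * \<i> * H z)) {0..2 * pi}"
    using has_integral_mult_right[OF 1[unfolded 2], of "-\<i>"] .
  moreover have "(-\<i>) * (\<i> * c) = c" "(-\<i>) * (2 * of_real pi * \<i> * c) = of_real (2 * pi) * c" for c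
    by (simp_all add: complex_eq_iff)
  ultimately show ?thesis by (simp only:)
qed

lemma poisson_kernel_eq:
  assumes "norm z < 1"
  shows "Re ((cis t + z) / (cis t - z)) = (1 - (norm z)^2) / (norm (cis t - z))^2"
proof -
  have *: "Re (a / b) = Re (a * cnj b) / (norm b)^2" for a b :: complex
    by (simp only: complex_div_cnj[of a b] Re_divide_of_real flip: of_real_power)
  have "Re ((cis t + z) * cnj (cis t - z)) = 1 - (norm z)^2"
    using sin_cos_squared_add[of t] by (simp only: cmod_power2) (simp add: algebra_simps power2_eq_square)
  then show ?thesis by (simp only: *)
qed

lemma cis_neq_inside: "norm z < 1 \<Longrightarrow> cis t - z \<noteq> 0"
  by (metis eq_iff_diff_eq_0 norm_cis order_less_irrefl)

text \<open>On the unit circle the Poisson kernel at \<open>z\<close> is the real part of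
  \<open>w \<mapsto> (1 + cnj z * w) / (1 - cnj z * w)\<close>, which is holomorphic across the circle and equals 1 at the
  origin.\<close>
lemma poisson_kernel_integral:
  assumes "norm z < 1"
  shows "((\<lambda>t. Re ((cis t + z) / (cis t - z))) has_integral 2 * pi) {0..2 * pi}"
proof -
  define H where "H w = (1 + cnj z * w) / (1 - cnj z * w)" for w
  have nz: "1 - cnj z * w \<noteq> 0" if "norm w \<le> 1" for w
  proof
    assume "1 - cnj z * w = 0"
    then have "norm (cnj z * w) = 1" by simp
    moreover have "norm (cnj z * w) \<le> norm z * 1"
      unfolding norm_mult complex_mod_cnj using that by (intro mult_left_mono) auto
    ultimately show False using assms by simp
  qed
  have "H holomorphic_on cball 0 1"
    unfolding H_def by (intro holomorphic_intros) (use nz in auto)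
  then have "((\<lambda>t. H (0 + of_real 1 * cis t)) has_integral of_real (2 * pi) * H 0) {0..2 * pi}"
    by (intro holomorphic_circle_mean)
       (auto intro: holomorphic_on_imp_continuous_on holomorphic_on_subset)
  from has_integral_Re[OF this]
  have "((\<lambda>t. Re (H (cis t))) has_integral 2 * pi) {0..2 * pi}"
    by (simp add: H_def)
  moreover have "Re (H (cis t)) = Re ((cis t + z) / (cis t - z))" for t
  proof -
    have c: "cis t * cnj (cis t) = 1" by (simp add: cis_cnj cis_mult)
    have "1 + cnj z * cis t = cis t * cnj (cis t + z)" "1 - cnj z * cis t = cis t * cnj (cis t - z)"
      using c by (simp_all add: ring_distribs mult.commute)
    then have "H (cis t) = cnj ((cis t + z) / (cis t - z))"
      by (simp add: H_def)
    then show ?thesis by (simp only: complex_cnj(1) cnj.sel)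
  qed
  ultimately show ?thesis by simp
qed

lemma norm_cis_diff_squared:
  "(norm (cis t - of_real r * cis x))^2 = 1 - 2 * r * cos (t - x) + r^2"
proof -
  have "(norm (cis t - of_real r * cis x))^2
     = (cos t * cos t + sin t * sin t) - 2 * r * (cos t * cos x + sin t * sin x)
       + r^2 * (cos x * cos x + sin x * sin x)"
    unfolding cmod_power2 by (simp add: power2_eq_square algebra_simps del: sin_cos_squared_add3)
  then show ?thesis by (simp add: cos_diff)
qed

text \<open>The real part is the Poisson integral of \<open>G\<close>; the imaginary part is the harmonic conjugate that
  vanishes at the origin.\<close>
definition schwarz_integral :: "(complex \<Rightarrow> real) \<Rightarrow> complex \<Rightarrow> complex" where
  "schwarz_integral G z =
     integral {0..2 * pi} (\<lambda>t. of_real (G (cis t)) * ((cis t + z) / (cis t - z))) / of_real (2 * pi)"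

context
  fixes G :: "complex \<Rightarrow> real"
  assumes cont_G: "continuous_on (sphere 0 1) G"
begin

lemma continuous_on_boundary [continuous_intros]: "continuous_on A (\<lambda>t. G (cis (h t)))"
  if "continuous_on A h"
  by (rule continuous_on_compose2[OF cont_G]) (auto intro!: continuous_intros that)

lemma schwarz_integrand_integrable:
  assumes "norm z < 1"
  shows "(\<lambda>t. of_real (G (cis t)) * ((cis t + z) / (cis t - z))) integrable_on {0..2 * pi}"
  by (intro integrable_continuous_real continuous_intros) (use cis_neq_inside[OF assms] in auto)

lemma schwarz_integral_holomorphic: "schwarz_integral G holomorphic_on ball 0 1"
proof -
  have "(\<lambda>z. integral (cbox 0 (2 * pi)) (\<lambda>t. of_real (G (cis t)) * ((cis t + z) / (cis t - z))))
          holomorphic_on ball 0 1"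
  proof (rule leibniz_rule_holomorphic[where
        fx = "\<lambda>z t. of_real (G (cis t)) * (2 * cis t / (cis t - z)^2)"])
    fix z :: complex and t :: real assume "z \<in> ball 0 1"
    then have "cis t - z \<noteq> 0" by (intro cis_neq_inside) auto
    then show "((\<lambda>z. of_real (G (cis t)) * ((cis t + z) / (cis t - z))) has_field_derivative
           of_real (G (cis t)) * (2 * cis t / (cis t - z)^2)) (at z within ball 0 1)"
      by (auto intro!: derivative_eq_intros simp: power2_eq_square divide_simps) (auto simp: algebra_simps)
  next
    fix z :: complex assume "z \<in> ball 0 1"
    then show "(\<lambda>t. of_real (G (cis t)) * ((cis t + z) / (cis t - z))) integrable_on cbox 0 (2 * pi)"
      using schwarz_integrand_integrable[of z] by (simp add: cbox_interval)
  next
    show "continuous_on (ball 0 1 \<times> cbox 0 (2 * pi))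
       (\<lambda>(z, t). of_real (G (cis t)) * (2 * cis t / (cis t - z)^2))"
      unfolding case_prod_unfold
      by (intro continuous_intros) (use cis_neq_inside in auto)
  qed simp
  then show ?thesis
    unfolding schwarz_integral_def cbox_interval by (intro holomorphic_intros) auto
qed

lemma schwarz_integral_0:
  "schwarz_integral G 0 = of_real (integral {0..2 * pi} (\<lambda>t. G (cis t)) / (2 * pi))"
proof -
  have "((\<lambda>t. complex_of_real (G (cis t))) has_integral of_real (integral {0..2 * pi} (\<lambda>t. G (cis t)))) {0..2 * pi}"
    by (intro has_integral_of_real integrable_integral integrable_continuous_real continuous_intros)
  then show ?thesis by (simp add: schwarz_integral_def integral_unique)
qed

lemma schwarz_integral_components:
  assumes "norm z < 1"
  shows "((\<lambda>t. G (cis t) * Re ((cis t + z) / (cis t - z))) has_integral 2 * pi * Re (schwarz_integral G z)) {0..2 * pi}"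
    and "((\<lambda>t. G (cis t) * Im ((cis t + z) / (cis t - z))) has_integral 2 * pi * Im (schwarz_integral G z)) {0..2 * pi}"
proof -
  note 1 = integrable_integral[OF schwarz_integrand_integrable[OF assms]]
  have 2: "integral {0..2 * pi} (\<lambda>t. of_real (G (cis t)) * ((cis t + z) / (cis t - z)))
     = of_real (2 * pi) * schwarz_integral G z"
    by (simp add: schwarz_integral_def)
  note 3 = 1[unfolded 2]
  have re: "Re (of_real a * q) = a * Re q" and im: "Im (of_real a * q) = a * Im q" for a q
    by simp_all
  show "((\<lambda>t. G (cis t) * Re ((cis t + z) / (cis t - z))) has_integral 2 * pi * Re (schwarz_integral G z)) {0..2 * pi}"
    using has_integral_Re[OF 3] unfolding re .
  show "((\<lambda>t. G (cis t) * Im ((cis t + z) / (cis t - z))) has_integral 2 * pi * Im (schwarz_integral G z)) {0..2 * pi}"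
    using has_integral_Im[OF 3] unfolding im .
qed

lemma poisson_kernel_nonneg: "norm z < 1 \<Longrightarrow> 0 \<le> Re ((cis t + z) / (cis t - z))"
  by (subst poisson_kernel_eq) (auto simp: abs_square_le_1)

lemma Re_schwarz_integral_bounds:
  assumes "norm z < 1" and "\<And>t. a \<le> G (cis t)" and "\<And>t. G (cis t) \<le> b"
  shows "a \<le> Re (schwarz_integral G z)" "Re (schwarz_integral G z) \<le> b"
proof -
  note P = poisson_kernel_integral[OF assms(1)]
  note S = schwarz_integral_components(1)[OF assms(1)]
  have "a * (2 * pi) \<le> 2 * pi * Re (schwarz_integral G z)"
    by (rule has_integral_le[OF has_integral_mult_right[OF P] S])
       (intro mult_right_mono assms poisson_kernel_nonneg)
  then show "a \<le> Re (schwarz_integral G z)" by (simp add: mult.commute)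
  have "2 * pi * Re (schwarz_integral G z) \<le> b * (2 * pi)"
    by (rule has_integral_le[OF S has_integral_mult_right[OF P]])
       (intro mult_right_mono assms poisson_kernel_nonneg)
  then show "Re (schwarz_integral G z) \<le> b" by (simp add: mult.commute)
qed

text \<open>Near the diagonal uniform continuity gives the bound \<open>e\<close>; away from it the quadratic term exceeds the
  oscillation of \<open>G\<close>. In this form a single moment of the Poisson kernel controls the boundary behaviour,
  and no integral has to be split.\<close>
lemma boundary_quadratic_modulus:
  assumes "0 < e"
  obtains C where "0 \<le> C"
    and "\<And>z w. norm z = 1 \<Longrightarrow> norm w = 1 \<Longrightarrow> \<bar>G z - G w\<bar> \<le> e + C * (norm (z - w))^2"
proof -
  have "uniformly_continuous_on (sphere 0 1) G"
    by (intro compact_uniformly_continuous cont_G) auto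
  then obtain d where d: "0 < d" "\<And>z w. z \<in> sphere 0 1 \<Longrightarrow> w \<in> sphere 0 1 \<Longrightarrow> dist z w < d \<Longrightarrow> dist (G z) (G w) < e"
    unfolding uniformly_continuous_on_def using assms by metis
  have "bounded (G ` sphere 0 1)"
    by (intro compact_imp_bounded compact_continuous_image cont_G) auto
  then obtain M where M: "\<And>z. z \<in> sphere 0 1 \<Longrightarrow> \<bar>G z\<bar> \<le> M"
    unfolding bounded_iff by (metis imageI real_norm_def)
  have M0: "0 \<le> M" using M[of 1] by auto
  show ?thesis
  proof
    show "0 \<le> 2 * M / d^2" using M0 by simp
    fix z w :: complex assume zw: "norm z = 1" "norm w = 1"
    show "\<bar>G z - G w\<bar> \<le> e + 2 * M / d^2 * (norm (z - w))^2"
    proof (cases "dist z w < d")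
      case True
      then have "\<bar>G z - G w\<bar> \<le> e" using d(2)[of z w] zw by (simp add: dist_real_def)
      then show ?thesis using M0 by (smt (verit) divide_nonneg_nonneg mult_nonneg_nonneg zero_le_power2)
    next
      case False
      then have "d^2 \<le> (norm (z - w))^2" using d(1) by (intro power_mono) (auto simp: dist_norm)
      then have "2 * M * 1 \<le> 2 * M * ((norm (z - w))^2 / d^2)"
        using M0 d(1) by (intro mult_left_mono) auto
      moreover have "\<bar>G z - G w\<bar> \<le> 2 * M" using M[of z] M[of w] zw by auto
      ultimately show ?thesis using assms by simp
    qed
  qed
qed

text \<open>From \<open>(1 - r)^2 \<ge> 0\<close> follows \<open>\<bar>cis t - r cis x\<bar>^2 \<ge> r \<bar>cis t - cis x\<bar>^2\<close>, so the quadratic weight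
  cancels the denominator of the kernel and leaves a factor that vanishes as \<open>r\<close> tends to 1.\<close>
lemma poisson_kernel_second_moment:
  assumes "0 < r" "r < 1"
  shows "Re ((cis t + of_real r * cis x) / (cis t - of_real r * cis x)) * (norm (cis t - cis x))^2 \<le> (1 - r^2) / r"
proof -
  have 1: "(norm (cis t - cis x))^2 = 2 * (1 - cos (t - x))" using norm_cis_diff_squared[of t 1 x] by simp
  have pos: "0 < (norm (cis t - of_real r * cis x))^2"
    using cis_neq_inside[of "of_real r * cis x" t] assms by (auto simp: norm_mult)
  have "r * (norm (cis t - cis x))^2 \<le> (norm (cis t - of_real r * cis x))^2"
    unfolding 1 norm_cis_diff_squared using zero_le_power2[of "1 - r"] by (simp add: power2_eq_square algebra_simps)
  then have "(norm (cis t - cis x))^2 / (norm (cis t - of_real r * cis x))^2 \<le> 1 / r"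
    using pos assms by (simp add: field_simps)
  then have "(1 - r^2) * ((norm (cis t - cis x))^2 / (norm (cis t - of_real r * cis x))^2) \<le> (1 - r^2) * (1 / r)"
    using assms by (intro mult_left_mono) (auto simp: abs_square_le_1 power_le_one)
  then show ?thesis
    using assms by (subst poisson_kernel_eq) (auto simp: norm_mult)
qed

lemma Re_schwarz_integral_boundary_rate:
  assumes "0 < r" "r < 1" "0 \<le> C"
    and mod: "\<And>z w. norm z = 1 \<Longrightarrow> norm w = 1 \<Longrightarrow> \<bar>G z - G w\<bar> \<le> e + C * (norm (z - w))^2"
  shows "\<bar>Re (schwarz_integral G (of_real r * cis x)) - G (cis x)\<bar> \<le> e + C * ((1 - r^2) / r)"
proof -
  define z where "z = of_real r * cis x"
  have z: "norm z < 1" using assms by (simp add: z_def norm_mult)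
  define P where "P t = Re ((cis t + z) / (cis t - z))" for t
  have Pint: "(P has_integral 2 * pi) {0..2 * pi}"
    unfolding P_def by (rule poisson_kernel_integral[OF z])
  have D: "((\<lambda>t. (G (cis t) - G (cis x)) * P t) has_integral 2 * pi * (Re (schwarz_integral G z) - G (cis x))) {0..2 * pi}"
    using has_integral_diff[OF schwarz_integral_components(1)[OF z, folded P_def] has_integral_mult_right[OF Pint, of "G (cis x)"]]
    by (simp add: algebra_simps)
  have B: "((\<lambda>t. e * P t + C * ((1 - r^2) / r)) has_integral e * (2 * pi) + 2 * pi * (C * ((1 - r^2) / r))) {0..2 * pi}"
    using has_integral_add[OF has_integral_mult_right[OF Pint, of e] has_integral_const_real[of "C * ((1 - r^2) / r)" 0 "2 * pi"]]
    by simp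
  have "norm (2 * pi * (Re (schwarz_integral G z) - G (cis x))) \<le> e * (2 * pi) + 2 * pi * (C * ((1 - r^2) / r))"
  proof (rule order_trans[OF eq_refl])
    show "norm (2 * pi * (Re (schwarz_integral G z) - G (cis x))) =
        norm (integral {0..2 * pi} (\<lambda>t. (G (cis t) - G (cis x)) * P t))"
      using D by (simp add: integral_unique)
    have "norm (integral {0..2 * pi} (\<lambda>t. (G (cis t) - G (cis x)) * P t))
       \<le> integral {0..2 * pi} (\<lambda>t. e * P t + C * ((1 - r^2) / r))"
    proof (rule integral_norm_bound_integral)
      fix t assume "t \<in> {0..2 * pi}"
      have P0: "0 \<le> P t" using poisson_kernel_nonneg[OF z] by (simp add: P_def)
      have "norm ((G (cis t) - G (cis x)) * P t) \<le> (e + C * (norm (cis t - cis x))^2) * P t"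
        using mod[of "cis t" "cis x"] P0 by (auto simp: abs_mult intro!: mult_right_mono)
      also have "\<dots> = e * P t + C * (P t * (norm (cis t - cis x))^2)" by (simp add: algebra_simps)
      also have "\<dots> \<le> e * P t + C * ((1 - r^2) / r)"
        using poisson_kernel_second_moment[OF assms(1,2), of t x] assms(3)
        by (intro add_left_mono mult_left_mono) (auto simp: P_def z_def)
      finally show "norm ((G (cis t) - G (cis x)) * P t) \<le> e * P t + C * ((1 - r^2) / r)" .
    qed (use D B in auto)
    then show "norm (integral {0..2 * pi} (\<lambda>t. (G (cis t) - G (cis x)) * P t)) \<le> e * (2 * pi) + 2 * pi * (C * ((1 - r^2) / r))"
      using B by (simp add: integral_unique)
  qed
  then have "2 * pi * \<bar>Re (schwarz_integral G z) - G (cis x)\<bar> \<le> 2 * pi * (e + C * ((1 - r^2) / r))"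
    unfolding real_norm_def abs_mult[of "2 * pi"] by (simp add: ring_distribs mult.commute[of e])
  then show ?thesis by (simp add: z_def)
qed

text \<open>Because of uniformity in \<open>x\<close>, the function \<open>z \<mapsto> schwarz_integral G (r * z)\<close>, which is holomorphic in
  a neighbourhood of the closed disc, has a real part close to \<open>G\<close> on the whole circle. This serves both to
  construct harmonic majorants and to recover the boundary heights of a thin disc.\<close>
lemma Re_schwarz_integral_boundary:
  "uniform_limit UNIV (\<lambda>r x. Re (schwarz_integral G (of_real r * cis x))) (\<lambda>x. G (cis x)) (at_left 1)"
proof (rule uniform_limitI)
  fix e :: real assume "0 < e"
  then obtain C where C: "0 \<le> C"
    "\<And>z w. norm z = 1 \<Longrightarrow> norm w = 1 \<Longrightarrow> \<bar>G z - G w\<bar> \<le> e / 2 + C * (norm (z - w))^2"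
    using boundary_quadratic_modulus[of "e / 2"] by auto
  have "((\<lambda>r. C * ((1 - r^2) / r)) \<longlongrightarrow> C * ((1 - 1^2) / 1)) (at_left 1)"
    by (intro tendsto_intros) auto
  then have "\<forall>\<^sub>F r in at_left (1::real). C * ((1 - r^2) / r) < e / 2"
    by (rule order_tendstoD) (use \<open>0 < e\<close> in auto)
  moreover have "\<forall>\<^sub>F r in at_left (1::real). 0 < r \<and> r < 1"
    by (rule eventually_at_leftI[of 0]) auto
  ultimately show "\<forall>\<^sub>F r in at_left 1. \<forall>x\<in>UNIV. dist (Re (schwarz_integral G (of_real r * cis x))) (G (cis x)) < e"
  proof eventually_elim
    case (elim r)
    show ?case
    proof
      fix x
      have "\<bar>Re (schwarz_integral G (of_real r * cis x)) - G (cis x)\<bar> \<le> e / 2 + C * ((1 - r^2) / r)"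
        by (rule Re_schwarz_integral_boundary_rate[OF _ _ C]) (use elim in auto)
      then show "dist (Re (schwarz_integral G (of_real r * cis x))) (G (cis x)) < e"
        using elim unfolding dist_real_def by linarith
    qed
  qed
qed

end

section \<open>The conjugate function and a Dini integral\<close>

text \<open>For an antiderivative \<open>F\<close> of \<open>h\<close>, the derivative of \<open>F(c + p) - F(c)\<close> with respect to \<open>c\<close> is
  \<open>h(c + p) - h(c) = 0\<close>.\<close>
lemma integral_period_shift:
  fixes h :: "real \<Rightarrow> real"
  assumes "continuous_on UNIV h" "\<And>t. h (t + p) = h t" "0 \<le> p"
  shows "integral {a..a + p} h = integral {0..p} h"
proof -
  define A B where "A = min a 0" and "B = max a 0"
  obtain F where F: "\<And>t. t \<in> {A..B + p} \<Longrightarrow> (F has_vector_derivative h t) (at t within {A..B + p})"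
    using antiderivative_continuous[of A "B + p" h] continuous_on_subset[OF assms(1)] by blast
  have int: "integral {c..c + p} h = F (c + p) - F c" if "c \<in> {A..B}" for c
    by (intro integral_unique fundamental_theorem_of_calculus has_vector_derivative_within_subset[OF F])
       (use that assms(3) in auto)
  have 1: "((\<lambda>c. F (c + p) - F c) has_vector_derivative 0) (at c within {A..B})" if "c \<in> {A..B}" for c
  proof -
    have "((\<lambda>c. F (c + p)) has_vector_derivative 1 *\<^sub>R h (c + p)) (at c within {A..B})"
      by (rule vector_diff_chain_within[of "\<lambda>c. c + p" 1 c "{A..B}" F "h (c + p)", unfolded o_def])
         (use that assms(3) in \<open>auto intro!: derivative_eq_intros has_vector_derivative_within_subset[OF F]\<close>)
    moreover have "(F has_vector_derivative h c) (at c within {A..B})"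
      by (rule has_vector_derivative_within_subset[OF F]) (use that assms(3) in auto)
    ultimately show ?thesis using has_vector_derivative_diff assms(2) by fastforce
  qed
  obtain k where k: "\<And>c. c \<in> {A..B} \<Longrightarrow> F (c + p) - F c = k"
    using has_vector_derivative_zero_constant[of "{A..B}" "\<lambda>c. F (c + p) - F c"] 1 by auto
  show ?thesis
    using int[of a] int[of 0] k[of a] k[of 0] by (auto simp: A_def B_def)
qed

lemma integral_period_fold:
  fixes h :: "real \<Rightarrow> real"
  assumes "continuous_on UNIV h" "\<And>t. h (t + 2 * pi) = h t"
  shows "((\<lambda>s. h (x + s) + h (x - s)) has_integral integral {0..2 * pi} h) {0..pi}"
proof -
  have c: "continuous_on A (\<lambda>s. h (u s))" if "continuous_on A u" for A :: "real set" and u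
    by (rule continuous_on_compose2[OF assms(1)]) (use that in auto)
  have i: "h integrable_on {a..b}" for a b
    by (intro integrable_continuous_real continuous_on_subset[OF assms(1)]) auto
  have "integral {0..2 * pi} h = integral {x - pi..x - pi + 2 * pi} h"
    by (rule integral_period_shift[symmetric]) (use assms in auto)
  also have "\<dots> = integral {x - pi..x} h + integral {x..x + pi} h"
    using Henstock_Kurzweil_Integration.integral_combine[of "x - pi" x "x + pi" h] i by (simp add: add.commute)
  finally have I: "integral {0..2 * pi} h = integral {x - pi..x} h + integral {x..x + pi} h" .
  have 1: "((\<lambda>s. h (x + s)) has_integral integral {x..x + pi} h) {0..pi}"
    using has_integral_shift_Icc_real[of h x "integral {x..x + pi} h" 0 pi] integrable_integral[OF i]
    by (simp add: add.commute o_def)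
  have "((\<lambda>s. h (x + s)) has_integral integral {x - pi..x} h) {-pi..-0}"
    using has_integral_shift_Icc_real[of h x "integral {x - pi..x} h" "-pi" 0] integrable_integral[OF i]
    by (simp add: add.commute o_def)
  then have "((\<lambda>s. h (x + - s)) has_integral integral {x - pi..x} h) {0..pi}"
    by (subst (asm) has_integral_reflect_real[symmetric]) simp
  from has_integral_add[OF 1 this] I show ?thesis
    by (simp only: add.commute diff_conv_add_uminus)
qed

text \<open>Up to the factor \<open>- 2\<close>, the imaginary part of the Schwarz kernel at distance \<open>r\<close> from the origin.\<close>
definition conj_poisson_kernel :: "real \<Rightarrow> real \<Rightarrow> real" where
  "conj_poisson_kernel r s = r * sin s / (1 - 2 * r * cos s + r^2)"

lemma conj_poisson_denominator_pos:
  fixes r s :: real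
  assumes "\<bar>r\<bar> < 1"
  shows "0 < 1 - 2 * r * cos s + r^2"
proof -
  have "r * cos s \<le> \<bar>r * cos s\<bar>" by (rule abs_ge_self)
  also have "\<dots> \<le> \<bar>r\<bar> * 1" unfolding abs_mult by (intro mult_left_mono) auto
  finally have "1 - 2 * r * cos s + r^2 \<ge> (1 - \<bar>r\<bar>)^2" by (simp add: power2_diff)
  moreover have "0 < (1 - \<bar>r\<bar>)^2" using assms by simp
  ultimately show ?thesis by linarith
qed

text \<open>The kernel is at most its limit \<open>cot (s / 2) / 2\<close> as \<open>r\<close> tends to 1, and \<open>tan (s / 2) \<ge> s / 2\<close>. The bound does not
  depend on \<open>r\<close>, and it is the source of the weight \<open>1 / t\<close> that matches the class A condition.\<close>
lemma conj_poisson_kernel_bounds: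
  assumes "0 \<le> r" "r < 1" "0 < s" "s < pi"
  shows "0 \<le> conj_poisson_kernel r s" "conj_poisson_kernel r s \<le> 1 / s"
proof -
  have sin: "0 < sin s" using assms sin_gt_zero by auto
  have den: "0 < 1 - 2 * r * cos s + r^2" using conj_poisson_denominator_pos[of r s] assms by auto
  show "0 \<le> conj_poisson_kernel r s"
    unfolding conj_poisson_kernel_def using assms sin den by (intro divide_nonneg_pos mult_nonneg_nonneg) auto
  have half: "s = 2 * (s / 2)" by simp
  have "s / 2 < pi / 2" "0 < s / 2" using assms by auto
  then have t: "s / 2 \<le> tan (s / 2)" and cp: "0 < cos (s / 2)"
    using tan_gt_zero[of "s / 2"] abs_tan_ge[of "s / 2"] cos_gt_zero_pi[of "s / 2"] by (auto simp: abs_if split: if_splits)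
  have sp: "0 < sin (s / 2)" using assms by (intro sin_gt_zero) auto
  have "s * sin s = 2 * (s / 2) * (2 * sin (s / 2) * cos (s / 2))"
    using sin_double[of "s / 2"] by simp
  also have "\<dots> \<le> 2 * tan (s / 2) * (2 * sin (s / 2) * cos (s / 2))"
    using t cp sp by (intro mult_right_mono mult_left_mono) auto
  also have "\<dots> = 2 * (2 * sin (s / 2)^2)" using cp by (simp add: tan_def power2_eq_square)
  also have "2 * sin (s / 2)^2 = 1 - cos s" using cos_double_sin[of "s / 2"] by simp
  finally have "r * (s * sin s) \<le> r * (2 * (1 - cos s))" using assms by (intro mult_left_mono) auto
  also have "\<dots> \<le> 1 - 2 * r * cos s + r^2"
    using zero_le_power2[of "1 - r"] by (simp add: power2_eq_square algebra_simps)
  finally have "r * sin s * s \<le> 1 - 2 * r * cos s + r^2" by (simp add: mult_ac)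
  then show "conj_poisson_kernel r s \<le> 1 / s"
    unfolding conj_poisson_kernel_def using den assms by (simp add: field_simps)
qed

lemma schwarz_kernel_Im:
  assumes "\<bar>r\<bar> < 1"
  shows "Im ((cis t + of_real r * cis x) / (cis t - of_real r * cis x)) = - 2 * conj_poisson_kernel r (t - x)"
proof -
  define z where "z = of_real r * cis x"
  have n: "(norm (cis t - z))^2 = 1 - 2 * r * cos (t - x) + r^2"
    unfolding z_def by (rule norm_cis_diff_squared)
  have *: "Im (a / b) = Im (a * cnj b) / (norm b)^2" for a b :: complex
    by (simp only: complex_div_cnj[of a b] Im_divide_of_real flip: of_real_power)
  have "Im ((cis t + z) * cnj (cis t - z)) = - 2 * (r * sin (t - x))"
    by (simp add: z_def algebra_simps sin_diff)
  then show ?thesis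
    unfolding z_def[symmetric] * n by (simp add: conj_poisson_kernel_def)
qed

context
  fixes G :: "complex \<Rightarrow> real"
  assumes cont_G: "continuous_on (sphere 0 1) G"
begin

text \<open>The conjugate kernel is odd, so opposite increments around the point \<open>x\<close> combine into symmetric
  differences of \<open>G\<close>.\<close>
lemma Im_schwarz_integral_fold:
  assumes "\<bar>r\<bar> < 1"
  shows "((\<lambda>s. (G (cis (x + s)) - G (cis (x - s))) * conj_poisson_kernel r s)
           has_integral - (pi * Im (schwarz_integral G (of_real r * cis x)))) {0..pi}"
proof -
  define h where "h t = G (cis t) * (- 2 * conj_poisson_kernel r (t - x))" for t
  have den: "1 - 2 * r * cos s + r^2 \<noteq> 0" for s
    using conj_poisson_denominator_pos[OF assms, of s] by simp
  have 1: "continuous_on UNIV h"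
    unfolding h_def conj_poisson_kernel_def
    by (intro continuous_intros continuous_on_boundary cont_G) (use den in auto)
  have sc: "sin (t + 2 * pi - x) = sin (t - x)" "cos (t + 2 * pi - x) = cos (t - x)" for t
    using sin_periodic[of "t - x"] cos_periodic[of "t - x"] by (simp_all add: algebra_simps)
  have 2: "h (t + 2 * pi) = h t" for t
  proof -
    have "cis (t + 2 * pi) = cis t" by (simp add: complex_eq_iff)
    then show ?thesis using sc[of t] by (simp add: h_def conj_poisson_kernel_def)
  qed
  have z: "norm (of_real r * cis x) < 1" using assms by (simp add: norm_mult)
  have "integral {0..2 * pi} h = 2 * pi * Im (schwarz_integral G (of_real r * cis x))"
    using schwarz_integral_components(2)[OF cont_G z] unfolding schwarz_kernel_Im[OF assms] h_def[symmetric]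
    by (rule integral_unique)
  then have "((\<lambda>s. h (x + s) + h (x - s)) has_integral 2 * pi * Im (schwarz_integral G (of_real r * cis x))) {0..pi}"
    using integral_period_fold[OF 1 2, of x] by simp
  from has_integral_mult_right[OF this, of "-1/2"]
  show ?thesis by (simp add: h_def conj_poisson_kernel_def algebra_simps diff_divide_distrib)
qed

text \<open>The estimate that makes the discs thin: it holds on the whole open disc and only sees symmetric
  differences of the boundary function.\<close>
lemma Im_schwarz_integral_bound:
  assumes "0 \<le> r" "r < 1" "0 \<le> c"
    and bound: "(\<integral>\<^sup>+ s \<in> {0<..<pi}. ennreal (\<bar>G (cis (x + s)) - G (cis (x - s))\<bar> / s) \<partial>lborel) \<le> ennreal c"
  shows "\<bar>Im (schwarz_integral G (of_real r * cis x))\<bar> \<le> c / pi"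
proof -
  define k where "k s = (G (cis (x + s)) - G (cis (x - s))) * conj_poisson_kernel r s" for s
  have r: "\<bar>r\<bar> < 1" using assms by simp
  note I = Im_schwarz_integral_fold[OF r, of x, folded k_def]
  have "continuous_on {0..pi} k"
    unfolding k_def conj_poisson_kernel_def
    by (intro continuous_intros continuous_on_boundary cont_G)
       (use conj_poisson_denominator_pos[OF r] in \<open>auto simp: less_imp_neq[symmetric]\<close>)
  then have ai: "(\<lambda>s. \<bar>k s\<bar>) integrable_on {0..pi}"
    by (intro integrable_continuous_real continuous_intros)
  have "ennreal (integral {0..pi} (\<lambda>s. \<bar>k s\<bar>)) = (\<integral>\<^sup>+ s. ennreal (indicator {0..pi} s * \<bar>k s\<bar>) \<partial>lborel)"
    using nn_integral_has_integral_lebesgue[OF _ integrable_integral[OF ai]] by simp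
  also have "\<dots> \<le> (\<integral>\<^sup>+ s \<in> {0<..<pi}. ennreal (\<bar>G (cis (x + s)) - G (cis (x - s))\<bar> / s) \<partial>lborel)"
  proof (rule nn_integral_mono_AE)
    have "AE s in lborel. s \<noteq> 0 \<and> s \<noteq> pi"
      by (intro AE_conjI AE_lborel_singleton)
    then show "AE s in lborel. ennreal (indicator {0..pi} s * \<bar>k s\<bar>)
      \<le> ennreal (\<bar>G (cis (x + s)) - G (cis (x - s))\<bar> / s) * indicator {0<..<pi} s"
    proof eventually_elim
      case (elim s)
      show ?case
      proof (cases "s \<in> {0<..<pi}")
        case True
        then have "\<bar>k s\<bar> \<le> \<bar>G (cis (x + s)) - G (cis (x - s))\<bar> * (1 / s)"
          unfolding k_def abs_mult using conj_poisson_kernel_bounds[OF assms(1,2), of s]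
          by (intro mult_left_mono) auto
        then show ?thesis using True by (simp add: ennreal_leI)
      qed (use elim in \<open>auto simp: indicator_def\<close>)
    qed
  qed
  also note bound
  finally have "integral {0..pi} (\<lambda>s. \<bar>k s\<bar>) \<le> c" using assms(3) by simp
  moreover have "norm (integral {0..pi} k) \<le> integral {0..pi} (\<lambda>s. \<bar>k s\<bar>)"
    by (rule integral_norm_bound_integral) (use I ai in auto)
  ultimately have "pi * \<bar>Im (schwarz_integral G (of_real r * cis x))\<bar> \<le> c"
    using I by (simp add: integral_unique abs_mult)
  then show ?thesis by (simp add: field_simps)
qed

end

section \<open>Upper semicontinuous functions\<close>

definition usc_on :: "'a::topological_space set \<Rightarrow> ('a \<Rightarrow> real) \<Rightarrow> bool" where
  "usc_on X F \<longleftrightarrow> (\<forall>x\<in>X. \<forall>c. F x < c \<longrightarrow> (\<forall>\<^sub>F y in at x within X. F y < c))"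

lemma usc_onD: "usc_on X F \<Longrightarrow> x \<in> X \<Longrightarrow> F x < c \<Longrightarrow> \<forall>\<^sub>F y in at x within X. F y < c"
  by (auto simp: usc_on_def)

lemma usc_on_subset: "usc_on X F \<Longrightarrow> Y \<subseteq> X \<Longrightarrow> usc_on Y F"
  unfolding usc_on_def by (meson filter_leD at_le subsetD)

lemma usc_on_add_continuous:
  assumes "usc_on X F" "continuous_on X g"
  shows "usc_on X (\<lambda>x. F x + g x)"
  unfolding usc_on_def
proof (intro ballI allI impI)
  fix x c assume x: "x \<in> X" and c: "F x + g x < c"
  define d where "d = (c - F x - g x) / 2"
  have "\<forall>\<^sub>F y in at x within X. F y < F x + d"
    by (rule usc_onD[OF assms(1) x]) (use c in \<open>simp add: d_def\<close>)
  moreover have "\<forall>\<^sub>F y in at x within X. g y < g x + d"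
    using assms(2) x c by (intro order_tendstoD) (auto simp: continuous_on_def d_def)
  ultimately show "\<forall>\<^sub>F y in at x within X. F y + g y < c"
  proof eventually_elim
    case (elim y)
    have "d + d = c - F x - g x" by (simp add: d_def)
    with elim show ?case by linarith
  qed
qed

lemma usc_on_compose:
  assumes "usc_on Y F" "continuous_on X f" "f ` X \<subseteq> Y"
  shows "usc_on X (\<lambda>x. F (f x))"
  unfolding usc_on_def
proof (intro ballI allI impI)
  fix x c assume x: "x \<in> X" and c: "F (f x) < c"
  have "\<forall>\<^sub>F y in at (f x) within Y. F y < c"
    by (rule usc_onD[OF assms(1)]) (use x c assms(3) in auto)
  then obtain U where U: "open U" "f x \<in> U" "\<And>y. y \<in> U \<Longrightarrow> y \<in> Y \<Longrightarrow> y \<noteq> f x \<Longrightarrow> F y < c"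
    unfolding eventually_at_topological by blast
  have "\<forall>\<^sub>F y in at x within X. f y \<in> U"
    using assms(2) x by (intro topological_tendstoD[OF _ U(1,2)]) (auto simp: continuous_on_def)
  moreover have "\<forall>\<^sub>F y in at x within X. y \<in> X" by (simp add: eventually_at_filter)
  ultimately show "\<forall>\<^sub>F y in at x within X. F (f y) < c"
    by eventually_elim (use U(3) c assms(3) in fastforce)
qed

text \<open>If every point were beaten by another one, finitely many of these competitors would beat every point
  of the compact set, including the best among themselves.\<close>
lemma usc_on_attains_max:
  assumes "usc_on X F" "compact X" "X \<noteq> {}"
  obtains x where "x \<in> X" "\<And>y. y \<in> X \<Longrightarrow> F y \<le> F x"
proof (rule ccontr)
  assume nt: "\<not> thesis"
  have "\<forall>x\<in>X. \<exists>y\<in>X. F x < F y"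
  proof
    fix x assume "x \<in> X"
    then show "\<exists>y\<in>X. F x < F y" using nt that[of x] by (meson not_le)
  qed
  then obtain b where b: "\<And>x. x \<in> X \<Longrightarrow> b x \<in> X \<and> F x < F (b x)" by metis
  have "\<exists>U. open U \<and> x \<in> U \<and> (\<forall>y\<in>U \<inter> X. F y < F (b x))" if "x \<in> X" for x
  proof -
    have "\<forall>\<^sub>F y in at x within X. F y < F (b x)"
      using usc_onD[OF assms(1) that] b[OF that] by simp
    then obtain U where "open U" "x \<in> U" "\<And>y. y \<in> U \<Longrightarrow> y \<noteq> x \<Longrightarrow> y \<in> X \<Longrightarrow> F y < F (b x)"
      unfolding eventually_at_topological by blast
    then show ?thesis using b[OF that] by (intro exI[of _ U]) auto
  qed
  then obtain U where U: "\<And>x. x \<in> X \<Longrightarrow> open (U x) \<and> x \<in> U x \<and> (\<forall>y\<in>U x \<inter> X. F y < F (b x))" by metis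
  obtain T where T: "T \<subseteq> X" "finite T" "X \<subseteq> (\<Union>x\<in>T. U x)"
    using compactE_image[OF assms(2), of X U] U by blast
  have "T \<noteq> {}" using T assms(3) by auto
  then have "Max ((\<lambda>x. F (b x)) ` T) \<in> (\<lambda>x. F (b x)) ` T" using T(2) by (intro Max_in) auto
  then obtain m where m: "m \<in> T" "Max ((\<lambda>x. F (b x)) ` T) = F (b m)" by blast
  have mx: "F (b x) \<le> F (b m)" if "x \<in> T" for x
    unfolding m(2)[symmetric] using T(2) that by (intro Max_ge) auto
  have "b m \<in> X" using b T m(1) by auto
  then obtain x where "x \<in> T" "b m \<in> U x" using T by auto
  then have "F (b m) < F (b x)" using U T \<open>b m \<in> X\<close> by blast
  then show False using mx[OF \<open>x \<in> T\<close>] by simp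
qed

lemma usc_on_open_sublevel:
  assumes "usc_on \<Omega> w" "open \<Omega>"
  shows "open {z \<in> \<Omega>. w z < c}"
proof (subst open_subopen, intro ballI)
  fix z assume z: "z \<in> {z \<in> \<Omega>. w z < c}"
  then have "\<forall>\<^sub>F y in at z within \<Omega>. w y < c" using usc_onD[OF assms(1)] by auto
  then obtain U where "open U" "z \<in> U" "\<And>y. y \<in> U \<Longrightarrow> y \<in> \<Omega> \<Longrightarrow> y \<noteq> z \<Longrightarrow> w y < c"
    unfolding eventually_at_topological by blast
  then show "\<exists>T. open T \<and> z \<in> T \<and> T \<subseteq> {z \<in> \<Omega>. w z < c}"
    using assms(2) z by (intro exI[of _ "U \<inter> \<Omega>"]) auto
qed

text \<open>Stated in the extended nonnegative reals, where the reverse Fatou lemma applies.\<close>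
lemma usc_on_limsup_le:
  fixes w :: "'a::topological_space \<Rightarrow> real"
  assumes "usc_on \<Omega> w" "open \<Omega>" "p \<longlonglongrightarrow> q" "q \<in> \<Omega>"
  shows "limsup (\<lambda>n. ennreal (w (p n))) \<le> ennreal (w q)"
proof (rule ennreal_le_epsilon)
  fix e :: real assume "0 < e"
  define c where "c = w q + e"
  have "open {z \<in> \<Omega>. w z < c}" by (rule usc_on_open_sublevel[OF assms(1,2)])
  then have "\<forall>\<^sub>F n in sequentially. p n \<in> {z \<in> \<Omega>. w z < c}"
    using assms(3,4) \<open>0 < e\<close> by (intro topological_tendstoD) (auto simp: c_def)
  then have "\<forall>\<^sub>F n in sequentially. ennreal (w (p n)) \<le> ennreal c"
    by eventually_elim (auto intro: ennreal_leI)
  then have "limsup (\<lambda>n. ennreal (w (p n))) \<le> ennreal c" by (rule Limsup_bounded)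
  also have "\<dots> \<le> ennreal (w q) + ennreal e"
    unfolding c_def using \<open>0 < e\<close>
    by (cases "0 \<le> w q") (auto simp: ennreal_plus intro!: order_trans[OF ennreal_leI[of "w q + e" e]])
  finally show "limsup (\<lambda>n. ennreal (w (p n))) \<le> ennreal (w q) + ennreal e" .
qed

text \<open>The approximations are the sup-convolutions \<open>sup\<^sub>y (F y - k * dist x y)\<close>. They are Lipschitz with
  constant \<open>k\<close>; for large \<open>k\<close> only points \<open>y\<close> close to \<open>x\<close> matter, and there \<open>F\<close> is at most slightly larger
  than \<open>F x\<close>.\<close>
lemma usc_on_approx_from_above:
  fixes X :: "'a::metric_space set"
  assumes F: "usc_on X F" and X: "X \<noteq> {}" and B: "\<And>x. x \<in> X \<Longrightarrow> F x \<le> B"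
  obtains g :: "nat \<Rightarrow> 'a \<Rightarrow> real" where
    "\<And>k. continuous_on X (g k)" "\<And>k x. x \<in> X \<Longrightarrow> F x \<le> g k x" "\<And>k x. x \<in> X \<Longrightarrow> g k x \<le> B"
    "\<And>x. x \<in> X \<Longrightarrow> (\<lambda>k. g k x) \<longlonglongrightarrow> F x"
proof
  define g where "g k x = (SUP y\<in>X. F y - real k * dist x y)" for k x
  have bdd: "bdd_above ((\<lambda>y. F y - real k * dist x y) ` X)" for k x
    by (rule bdd_aboveI[of _ B]) (use B in \<open>force intro: order_trans[OF diff_left_mono[of 0]]\<close>)
  have upper: "F y - real k * dist x y \<le> g k x" if "y \<in> X" for k x y
    unfolding g_def by (rule cSUP_upper[OF that bdd])
  show F_le: "F x \<le> g k x" if "x \<in> X" for k x using upper[OF that, of k x] by simp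
  show "g k x \<le> B" if "x \<in> X" for k x
    unfolding g_def by (rule cSUP_least[OF X]) (use B in \<open>force intro: order_trans[OF diff_left_mono[of 0]]\<close>)
  have lip: "g k x \<le> g k x' + real k * dist x x'" for k x x'
  proof -
    have "F y - real k * dist x y \<le> g k x' + real k * dist x x'" if "y \<in> X" for y
    proof -
      have "dist x' y \<le> dist x x' + dist x y" by (metis dist_commute dist_triangle)
      then have "real k * dist x' y \<le> real k * (dist x x' + dist x y)" by (intro mult_left_mono) auto
      then show ?thesis using upper[OF that, of k x'] by (simp add: distrib_left)
    qed
    then show ?thesis unfolding g_def[of k x] by (intro cSUP_least[OF X]) auto
  qed
  show "continuous_on X (g k)" for k
  proof (rule lipschitz_on_continuous_on)
    show "(real k)-lipschitz_on X (g k)"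
    proof (rule lipschitz_onI)
      fix x y show "dist (g k x) (g k y) \<le> real k * dist x y"
        using lip[of k x y] lip[of k y x] by (simp add: dist_real_def dist_commute)
    qed simp
  qed
  fix x assume x: "x \<in> X"
  show "(\<lambda>k. g k x) \<longlonglongrightarrow> F x"
  proof (rule order_tendstoI)
    fix a assume "a < F x"
    then show "\<forall>\<^sub>F k in sequentially. a < g k x"
      using F_le[OF x] by (auto intro!: always_eventually intro: less_le_trans)
  next
    fix a assume "F x < a"
    then obtain c where c: "F x < c" "c < a" using dense by blast
    have "\<forall>\<^sub>F y in at x within X. F y < c" by (rule usc_onD[OF F x c(1)])
    then obtain d where d: "0 < d" "\<And>y. y \<in> X \<Longrightarrow> y \<noteq> x \<Longrightarrow> dist y x < d \<Longrightarrow> F y < c"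
      unfolding eventually_at by blast
    obtain N :: nat where N: "(B - c) / d \<le> real N" using real_arch_simple by blast
    have "g k x \<le> c" if "N \<le> k" for k
      unfolding g_def
    proof (rule cSUP_least[OF X])
      fix y assume y: "y \<in> X"
      show "F y - real k * dist x y \<le> c"
      proof (cases "dist y x < d")
        case True
        then have "F y < c" using d(2)[OF y] c(1) by (cases "y = x") auto
        moreover have "0 \<le> real k * dist x y" by simp
        ultimately show ?thesis by linarith
      next
        case False
        have "B - c \<le> real N * d" using N d(1) by (simp add: field_simps)
        also have "\<dots> \<le> real k * dist x y"
          using that False d(1) by (intro mult_mono) (auto simp: dist_commute)
        finally show ?thesis using B[OF y] by linarith
      qed
    qed
    then show "\<forall>\<^sub>F k in sequentially. g k x < a"
      using c(2) unfolding eventually_sequentially by (meson le_less_trans)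
  qed
qed

section \<open>Subharmonic functions on holomorphic discs\<close>

text \<open>The form in which positive parts of subharmonic functions are used: finite real values, extended by 0
  so that the function is Borel on the plane, and means as integrals of nonnegative functions, which need
  no integrability.\<close>
definition nonneg_subharmonic :: "(complex \<Rightarrow> real) \<Rightarrow> complex set \<Rightarrow> bool" where
  "nonneg_subharmonic w \<Omega> \<longleftrightarrow> open \<Omega> \<and> (\<forall>z. 0 \<le> w z) \<and> (\<forall>z. z \<notin> \<Omega> \<longrightarrow> w z = 0) \<and> usc_on \<Omega> w \<and>
     (\<forall>z r. 0 < r \<longrightarrow> cball z r \<subseteq> \<Omega> \<longrightarrow>
        ennreal (2 * pi * w z) \<le> (\<integral>\<^sup>+ t \<in> {0..2 * pi}. ennreal (w (z + of_real r * cis t)) \<partial>lborel))"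

lemma nonneg_subharmonicD:
  assumes "nonneg_subharmonic w \<Omega>"
  shows "open \<Omega>" "0 \<le> w z" "usc_on \<Omega> w" "z \<notin> \<Omega> \<Longrightarrow> w z = 0"
    "0 < r \<Longrightarrow> cball z r \<subseteq> \<Omega> \<Longrightarrow>
        ennreal (2 * pi * w z) \<le> (\<integral>\<^sup>+ t \<in> {0..2 * pi}. ennreal (w (z + of_real r * cis t)) \<partial>lborel)"
  using assms by (auto simp: nonneg_subharmonic_def)

lemma nonneg_subharmonic_measurable:
  assumes "nonneg_subharmonic w \<Omega>"
  shows "w \<in> borel_measurable borel"
proof (rule borel_measurableI_less)
  fix c
  note D = nonneg_subharmonicD[OF assms]
  have "{z. w z < c} = {z \<in> \<Omega>. w z < c} \<union> (if 0 < c then - \<Omega> else {})"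
    using D(2,4) by (auto simp: not_less[symmetric] split: if_splits) (metis not_less)+
  moreover have "open {z \<in> \<Omega>. w z < c}" by (intro usc_on_open_sublevel D)
  ultimately show "{z \<in> space borel. w z < c} \<in> sets borel"
    using D(1) by auto
qed

text \<open>The mean of the right-hand side over the circle is \<open>w p - \<eta>\<close>, which contradicts the mean value
  inequality at \<open>p\<close>.\<close>
lemma no_strict_harmonic_majorant:
  assumes w: "nonneg_subharmonic w \<Omega>" and "0 < r" "cball p r \<subseteq> \<Omega>" "0 < \<eta>"
    and R: "R holomorphic_on cball p r"
    and le: "\<And>t. w (p + of_real r * cis t) \<le> w p + Re (R (p + of_real r * cis t)) - Re (R p) - \<eta>"
  shows False
proof -
  note D = nonneg_subharmonicD[OF w]
  define h where "h t = w p + Re (R (p + of_real r * cis t)) - Re (R p) - \<eta>" for t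
  have "((\<lambda>t. R (p + of_real r * cis t)) has_integral of_real (2 * pi) * R p) {0..2 * pi}"
    by (intro holomorphic_circle_mean holomorphic_on_imp_continuous_on R holomorphic_on_subset[OF R] assms) auto
  from has_integral_add[OF has_integral_Re[OF this] has_integral_const_real[of "w p - Re (R p) - \<eta>" 0 "2 * pi"]]
  have H: "(h has_integral 2 * pi * (w p - \<eta>)) {0..2 * pi}"
    unfolding h_def by (simp add: algebra_simps)
  have h0: "0 \<le> h t" for t using le[of t] D(2)[of "p + of_real r * cis t"] by (simp add: h_def)
  have "ennreal (2 * pi * w p) \<le> (\<integral>\<^sup>+ t \<in> {0..2 * pi}. ennreal (w (p + of_real r * cis t)) \<partial>lborel)"
    by (rule D(5)) (use assms in auto)
  also have "\<dots> \<le> (\<integral>\<^sup>+ t \<in> {0..2 * pi}. ennreal (h t) \<partial>lborel)"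
    using le by (intro nn_integral_mono mult_right_mono ennreal_leI) (auto simp: h_def)
  also have "\<dots> = ennreal (2 * pi * (w p - \<eta>))"
    using nn_integral_has_integral_lebesgue'[OF _ H] h0 by simp
  finally have "2 * pi * w p \<le> 2 * pi * (w p - \<eta>)"
    using has_integral_nonneg[OF H] h0 by (subst (asm) ennreal_le_iff) auto
  then show False using \<open>0 < \<eta>\<close> by simp
qed

text \<open>Since the derivative of \<open>f\<close> at \<open>a\<close> does not vanish, \<open>f\<close> has a holomorphic local inverse \<open>g\<close>, and the
  majorant can be transported to a small circle around \<open>f a\<close>. There \<open>\<bar>g - a\<bar>^2\<close> is bounded away from 0,
  which supplies a strict gap.\<close>
lemma no_strict_pulled_back_majorant:
  assumes w: "nonneg_subharmonic w \<Omega>" and V: "open V" "a \<in> V" and "0 < \<eta>"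
    and f: "f holomorphic_on V" "f ` V \<subseteq> \<Omega>" "deriv f a \<noteq> 0" and R: "R holomorphic_on V"
    and le: "\<And>z. z \<in> V \<Longrightarrow> w (f z) \<le> w (f a) + Re (R z) - Re (R a) - \<eta> * (norm (z - a))^2"
  shows False
proof -
  obtain \<rho> where \<rho>: "\<rho> > 0" "ball a \<rho> \<subseteq> V" "open (f ` ball a \<rho>)" "inj_on f (ball a \<rho>)"
    using has_complex_derivative_locally_invertible[OF f(1) V(2,1) f(3)] by blast
  have fB: "f holomorphic_on ball a \<rho>" using f(1) \<rho>(2) by (rule holomorphic_on_subset)
  obtain g where g: "g holomorphic_on f ` ball a \<rho>" "\<And>z. z \<in> ball a \<rho> \<Longrightarrow> g (f z) = z"
    by (rule holomorphic_has_inverse[OF fB open_ball \<rho>(4)]) blast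
  have "f a \<in> f ` ball a \<rho>" using \<rho>(1) by auto
  then obtain r where r: "0 < r" "cball (f a) r \<subseteq> f ` ball a \<rho>"
    using \<rho>(3) open_contains_cball by blast
  have gB: "g z \<in> ball a \<rho>" "f (g z) = z" if "z \<in> cball (f a) r" for z
    using that r(2) g(2) by auto
  have gc: "continuous_on (cball (f a) r) g"
    using g(1) r(2) holomorphic_on_imp_continuous_on holomorphic_on_subset by blast
  have ga: "g (f a) = a" using g(2) \<rho>(1) by simp
  have "continuous_on (sphere (f a) r) (\<lambda>z. norm (g z - a))"
    by (intro continuous_intros continuous_on_subset[OF gc]) auto
  then obtain q where q: "q \<in> sphere (f a) r" "\<And>z. z \<in> sphere (f a) r \<Longrightarrow> norm (g q - a) \<le> norm (g z - a)"
    using continuous_attains_inf[of "sphere (f a) r" "\<lambda>z. norm (g z - a)"] r(1) by auto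
  have "g q \<noteq> a" using gB(2)[of q] q(1) r(1) by auto
  define m where "m = (norm (g q - a))^2"
  have "0 < m" using \<open>g q \<noteq> a\<close> by (simp add: m_def)
  show False
  proof (rule no_strict_harmonic_majorant[OF w r(1)])
    show "cball (f a) r \<subseteq> \<Omega>" using r(2) \<rho>(2) f(2) by blast
    show "0 < \<eta> * m" using \<open>0 < m\<close> \<open>0 < \<eta>\<close> by simp
    show "(R \<circ> g) holomorphic_on cball (f a) r"
    proof (rule holomorphic_on_compose)
      show "g holomorphic_on cball (f a) r" using g(1) r(2) by (rule holomorphic_on_subset)
      show "R holomorphic_on g ` cball (f a) r"
        using gB \<rho>(2) by (intro holomorphic_on_subset[OF R]) auto
    qed
    fix t
    define z where "z = f a + of_real r * cis t"
    have zs: "z \<in> sphere (f a) r" using r(1) by (simp add: z_def dist_norm norm_mult)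
    then have zc: "z \<in> cball (f a) r" by auto
    have "m \<le> (norm (g z - a))^2" unfolding m_def using q(2)[OF zs] by (intro power_mono) auto
    then have "\<eta> * m \<le> \<eta> * (norm (g z - a))^2" using \<open>0 < \<eta>\<close> by simp
    moreover have "w (f (g z)) \<le> w (f a) + Re (R (g z)) - Re (R a) - \<eta> * (norm (g z - a))^2"
      by (rule le) (use gB[OF zc] \<rho>(2) in auto)
    ultimately show "w z \<le> w (f a) + Re ((R \<circ> g) z) - Re ((R \<circ> g) (f a)) - \<eta> * m"
      using gB(2)[OF zc] ga by simp
  qed
qed

text \<open>The maximum principle for \<open>w \<circ> f - Re H\<close>. At an interior maximum with nonvanishing derivative of \<open>f\<close>
  a local inverse of \<open>f\<close> leads back to the mean value inequality for \<open>w\<close>; critical points are the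
  obstacle. Adding the small multiple \<open>\<eta> * ln \<bar>f'\<bar>\<close>, which is \<open>-\<infinity>\<close> there and locally the real part of a
  holomorphic function elsewhere, moves the maximum away from them, and adding \<open>\<eta> * \<bar>z\<bar>^2\<close> makes the
  inequality strict. The assumption \<open>deriv f 0 \<noteq> 0\<close> keeps the perturbation finite at the origin, where the
  values are compared.\<close>
lemma subharmonic_compose_max_principle:
  assumes w: "nonneg_subharmonic w \<Omega>" and S: "open S" "cball 0 1 \<subseteq> S"
    and f: "f holomorphic_on S" "f ` cball 0 1 \<subseteq> \<Omega>" "deriv f 0 \<noteq> 0"
    and H: "H holomorphic_on S"
    and bd: "\<And>z. norm z = 1 \<Longrightarrow> w (f z) \<le> Re (H z)"
  shows "w (f 0) \<le> Re (H 0)"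
proof (rule ccontr)
  assume nt: "\<not> ?thesis"
  define A where "A = w (f 0) - Re (H 0)"
  have A: "0 < A" using nt by (simp add: A_def)
  note D = nonneg_subharmonicD[OF w]
  have D': "deriv f holomorphic_on S" using f(1) S(1) by (rule holomorphic_deriv)
  define F where "F z = w (f z) - Re (H z)" for z
  have contf: "continuous_on (cball 0 1) f" and contH: "continuous_on (cball 0 1) H"
    and contD: "continuous_on (cball 0 1) (deriv f)"
    using f(1) H D' S(2) holomorphic_on_imp_continuous_on holomorphic_on_subset by blast+
  have uscF: "usc_on (cball 0 1) F"
  proof -
    have "continuous_on (cball 0 1) (\<lambda>z. - Re (H z))" by (intro continuous_intros contH)
    from usc_on_add_continuous[OF usc_on_compose[OF D(3) contf f(2)] this]
    show ?thesis by (simp add: F_def[abs_def])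
  qed
  obtain b where b: "\<And>z. z \<in> cball 0 1 \<Longrightarrow> F z \<le> F b"
    using usc_on_attains_max[OF uscF] by auto
  define B where "B = F b"
  have "bounded (deriv f ` cball 0 1)"
    by (intro compact_imp_bounded compact_continuous_image contD) auto
  then obtain M where M: "0 < M" "\<And>z. z \<in> cball 0 1 \<Longrightarrow> norm (deriv f z) \<le> M"
    unfolding bounded_pos by auto
  define d0 where "d0 = ln (norm (deriv f 0))"
  \<comment> \<open>The weight is so small that a boundary maximum would still be below the value at the
    origin.\<close>
  define \<eta> where "\<eta> = A / (2 * (\<bar>ln M\<bar> + 1 + \<bar>d0\<bar>))"
  have den: "0 < \<bar>ln M\<bar> + 1 + \<bar>d0\<bar>" by simp
  have \<eta>: "0 < \<eta>" using A den by (simp add: \<eta>_def)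
  have "\<eta> * (\<bar>ln M\<bar> + 1 + \<bar>d0\<bar>) = A / 2" using den unfolding \<eta>_def by (simp add: field_simps)
  moreover have "\<eta> * (ln M + 1 - d0) \<le> \<eta> * (\<bar>ln M\<bar> + 1 + \<bar>d0\<bar>)" using \<eta> by (intro mult_left_mono) auto
  ultimately have \<eta>A: "\<eta> * ln M + \<eta> < A + \<eta> * d0" using A by (simp add: algebra_simps)
  define V where "V z = F z + (\<eta> * ln (norm (deriv f z)) + \<eta> * (norm z)^2)" for z
  have V0: "V 0 = A + \<eta> * d0" by (simp add: V_def F_def A_def d0_def)
  \<comment> \<open>Points where the derivative is smaller than this threshold cannot compete with the
    origin, so the maximum may be sought on a compact set on which the logarithm is continuous.\<close>
  define \<kappa> where "\<kappa> = min (norm (deriv f 0)) (exp ((V 0 - \<eta> - B) / \<eta>))"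
  have \<kappa>: "0 < \<kappa>" using f(3) by (simp add: \<kappa>_def)
  have small: "V z \<le> V 0" if z: "z \<in> cball 0 1" "norm (deriv f z) < \<kappa>" "deriv f z \<noteq> 0" for z
  proof -
    have "norm (deriv f z) \<le> exp ((V 0 - \<eta> - B) / \<eta>)" using z by (simp add: \<kappa>_def)
    then have "ln (norm (deriv f z)) \<le> (V 0 - \<eta> - B) / \<eta>"
      using z(3) by (metis exp_gt_zero ln_exp ln_le_cancel_iff zero_less_norm_iff)
    then have "\<eta> * ln (norm (deriv f z)) \<le> V 0 - \<eta> - B" using \<eta> by (simp add: field_simps)
    moreover have "\<eta> * (norm z)^2 \<le> \<eta> * 1" using z(1) \<eta> by (intro mult_left_mono) (auto simp: power_le_one)
    ultimately show ?thesis using b[OF z(1)] by (simp add: V_def B_def)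
  qed
  define X where "X = {z \<in> cball 0 1. \<kappa> \<le> norm (deriv f z)}"
  have "closed X" unfolding X_def
    by (rule continuous_closed_preimage[of _ _ "{\<kappa>..}", simplified vimage_def Int_def, simplified])
       (auto intro!: continuous_intros contD)
  then have "compact X" by (metis (no_types, lifting) X_def bounded_cball bounded_subset compact_eq_bounded_closed mem_Collect_eq subsetI)
  moreover have "0 \<in> X" by (simp add: X_def \<kappa>_def)
  moreover have "usc_on X V"
    unfolding V_def
  proof (rule usc_on_add_continuous[OF usc_on_subset[OF uscF]])
    show "X \<subseteq> cball 0 1" by (auto simp: X_def)
    then have "continuous_on X (deriv f)" by (rule continuous_on_subset[OF contD])
    then show "continuous_on X (\<lambda>z. \<eta> * ln (norm (deriv f z)) + \<eta> * (norm z)^2)"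
      by (intro continuous_intros) (use \<kappa> in \<open>auto simp: X_def\<close>)
  qed
  ultimately obtain a where a: "a \<in> X" "\<And>z. z \<in> X \<Longrightarrow> V z \<le> V a"
    using usc_on_attains_max[of X V] by auto
  have a1: "a \<in> cball 0 1" "deriv f a \<noteq> 0" using a(1) \<kappa> by (auto simp: X_def)
  have max: "V z \<le> V a" if "z \<in> cball 0 1" "deriv f z \<noteq> 0" for z
    using small[of z] a(2)[of z] a(2)[OF \<open>0 \<in> X\<close>] that by (fastforce simp: X_def)
  have "norm a \<noteq> 1"
  proof
    assume 1: "norm a = 1"
    have "ln (norm (deriv f a)) \<le> ln M" using M a1 by simp
    then have "\<eta> * ln (norm (deriv f a)) \<le> \<eta> * ln M" using \<eta> by simp
    then have "V a \<le> \<eta> * ln M + \<eta>" using bd[OF 1] 1 by (simp add: V_def F_def)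
    then show False using \<eta>A V0 a(2)[OF \<open>0 \<in> X\<close>] by simp
  qed
  then have ain: "a \<in> ball 0 1 \<inter> {z \<in> S. deriv f z \<noteq> 0}" using a1 S by auto
  have op: "open {z \<in> S. deriv f z \<noteq> 0}"
    using continuous_open_preimage[OF holomorphic_on_imp_continuous_on[OF D'] S(1), of "- {0}"]
    by (auto simp: vimage_def Int_def)
  obtain \<rho> where \<rho>: "0 < \<rho>" "ball a \<rho> \<subseteq> ball 0 1 \<inter> {z \<in> S. deriv f z \<noteq> 0}"
    by (rule openE[OF open_Int[OF open_ball op] ain])
  obtain L where L: "L holomorphic_on ball a \<rho>" "\<And>z. z \<in> ball a \<rho> \<Longrightarrow> exp (L z) = deriv f z"
  proof (rule holomorphic_logarithm_exists[of "ball a \<rho>" "deriv f" a])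
    show "deriv f holomorphic_on ball a \<rho>" using \<rho>(2) by (intro holomorphic_on_subset[OF D']) auto
    show "deriv f x \<noteq> 0" if "x \<in> ball a \<rho>" for x using that \<rho>(2) by blast
  qed (use \<rho>(1) that in auto)
  have lnL: "ln (norm (deriv f z)) = Re (L z)" if "z \<in> ball a \<rho>" for z
    using L(2)[OF that, symmetric] by simp
  \<comment> \<open>Expanding \<open>\<bar>z\<bar>^2\<close> around \<open>a\<close> splits it into the real
    part of a linear function, which joins the harmonic majorant, and a square that is positive away from
    \<open>a\<close>.\<close>
  define R where "R z = H z - of_real \<eta> * L z - 2 * of_real \<eta> * cnj a * z" for z
  show False
  proof (rule no_strict_pulled_back_majorant[OF w, of "ball a \<rho>" a \<eta> f R])
    show "f holomorphic_on ball a \<rho>" using \<rho>(2) by (intro holomorphic_on_subset[OF f(1)]) auto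
    show "f ` ball a \<rho> \<subseteq> \<Omega>" using \<rho>(2) f(2) by (auto simp: subset_iff image_subset_iff)
    show "R holomorphic_on ball a \<rho>"
      unfolding R_def using \<rho>(2) by (intro holomorphic_intros L holomorphic_on_subset[OF H]) auto
    fix z assume z: "z \<in> ball a \<rho>"
    have n: "(norm z)^2 = (norm a)^2 + (norm (z - a))^2 + Re (2 * cnj a * z) - Re (2 * cnj a * a)"
      unfolding cmod_power2 by (simp add: power2_eq_square algebra_simps)
    have "z \<in> ball 0 1 \<inter> {z \<in> S. deriv f z \<noteq> 0}" using z \<rho>(2) by blast
    then have "V z \<le> V a" by (intro max) auto
    then have "w (f z) \<le> w (f a) + (Re (H z) - \<eta> * Re (L z) - \<eta> * (norm z)^2) - (Re (H a) - \<eta> * Re (L a) - \<eta> * (norm a)^2)"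
      using lnL[OF z] lnL[of a] \<rho>(1) by (simp add: V_def F_def)
    then show "w (f z) \<le> w (f a) + Re (R z) - Re (R a) - \<eta> * (norm (z - a))^2"
      unfolding n R_def by (simp add: algebra_simps)
  qed (use \<rho> \<eta> a1 in auto)
qed

text \<open>The boundary values of \<open>w \<circ> f\<close> are upper semicontinuous, hence limits of continuous functions lying
  above them. A continuous function on the circle is, up to a small error, the boundary value of the real
  part of a Schwarz integral that is holomorphic past the circle, so the maximum principle applies, and
  the value of this majorant at the origin is the mean of its boundary values.\<close>
lemma nonneg_subharmonic_holomorphic_disc:
  assumes w: "nonneg_subharmonic w \<Omega>" and S: "open S" "cball 0 1 \<subseteq> S"
    and f: "f holomorphic_on S" "f ` cball 0 1 \<subseteq> \<Omega>" "deriv f 0 \<noteq> 0"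
  shows "ennreal (2 * pi * w (f 0)) \<le> (\<integral>\<^sup>+ t \<in> {0..2 * pi}. ennreal (w (f (cis t))) \<partial>lborel)"
proof -
  note D = nonneg_subharmonicD[OF w]
  define X where "X = sphere (0::complex) 1"
  have contf: "continuous_on X f"
    using f(1) S(2) holomorphic_on_imp_continuous_on holomorphic_on_subset
    by (metis X_def continuous_on_subset sphere_cball)
  have "f ` X \<subseteq> \<Omega>" using f(2) by (force simp: X_def)
  from usc_on_compose[OF D(3) contf this] have usc: "usc_on X (\<lambda>z. w (f z))" .
  have X: "compact X" "X \<noteq> {}" by (simp_all add: X_def)
  have cisX: "cis t \<in> X" for t by (simp add: X_def)
  obtain b where b: "\<And>z. z \<in> X \<Longrightarrow> w (f z) \<le> w (f b)"
    by (rule usc_on_attains_max[OF usc X]) blast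
  define B where "B = w (f b)"
  obtain g :: "nat \<Rightarrow> complex \<Rightarrow> real" where
    g: "\<And>k. continuous_on X (g k)" "\<And>k x. x \<in> X \<Longrightarrow> w (f x) \<le> g k x" "\<And>k x. x \<in> X \<Longrightarrow> g k x \<le> B"
      "\<And>x. x \<in> X \<Longrightarrow> (\<lambda>k. g k x) \<longlonglongrightarrow> w (f x)"
    using usc_on_approx_from_above[OF usc X(2), of B] b unfolding B_def by blast
  have g0: "0 \<le> g k (cis t)" for k t using g(2)[OF cisX] D(2) order_trans by blast
  have gc: "continuous_on UNIV (\<lambda>t. g k (cis t))" for k
    using continuous_on_boundary[OF g(1)[unfolded X_def]] continuous_on_id by blast
  have mean: "w (f 0) * (2 * pi) \<le> integral {0..2 * pi} (\<lambda>t. g k (cis t))" for k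
  proof -
    note gk = g(1)[of k, unfolded X_def]
    have "w (f 0) \<le> integral {0..2 * pi} (\<lambda>t. g k (cis t)) / (2 * pi)"
    proof (rule field_le_epsilon)
      fix e :: real assume "0 < e"
      have "\<forall>\<^sub>F r in at_left 1. \<forall>x\<in>UNIV. dist (Re (schwarz_integral (g k) (of_real r * cis x))) (g k (cis x)) < e"
        by (rule uniform_limitD[OF Re_schwarz_integral_boundary[OF gk] \<open>0 < e\<close>])
      moreover have "\<forall>\<^sub>F r in at_left (1::real). 0 < r \<and> r < 1"
        by (rule eventually_at_leftI[of 0]) auto
      ultimately have "\<forall>\<^sub>F r in at_left (1::real). 0 < r \<and> r < 1 \<and>
           (\<forall>x. dist (Re (schwarz_integral (g k) (of_real r * cis x))) (g k (cis x)) < e)"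
        by eventually_elim auto
      then obtain r where r: "0 < r" "r < 1"
        "\<And>x. dist (Re (schwarz_integral (g k) (of_real r * cis x))) (g k (cis x)) < e"
        using eventually_happens[of _ "at_left (1::real)"] by auto
      define H where "H z = schwarz_integral (g k) (of_real r * z) + of_real e" for z
      have "w (f 0) \<le> Re (H 0)"
      proof (rule subharmonic_compose_max_principle[OF w, of "S \<inter> ball 0 (1 / r)" f H])
        have "r * norm x < 1" if "norm x \<le> 1" for x :: complex
        proof -
          have "r * norm x \<le> r * 1" using that r(1) by (intro mult_left_mono) auto
          then show ?thesis using r(2) by linarith
        qed
        then show "cball 0 1 \<subseteq> S \<inter> ball 0 (1 / r)" using S(2) r(1) by (auto simp: field_simps)
        show "f holomorphic_on S \<inter> ball 0 (1 / r)" using f(1) by (rule holomorphic_on_subset) auto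
        have "schwarz_integral (g k) \<circ> (\<lambda>z. of_real r * z) holomorphic_on S \<inter> ball 0 (1 / r)"
          by (rule holomorphic_on_compose_gen[OF _ schwarz_integral_holomorphic[OF gk]])
             (use r in \<open>auto intro!: holomorphic_intros simp: norm_mult field_simps\<close>)
        then show "H holomorphic_on S \<inter> ball 0 (1 / r)"
          unfolding H_def o_def by (intro holomorphic_intros)
        fix z :: complex assume z: "norm z = 1"
        define x where "x = Arg z"
        have zx: "z = cis x" using z cis_Arg[of z] by (cases "z = 0") (auto simp: x_def sgn_eq)
        have "w (f z) \<le> g k z" by (rule g(2)) (simp add: X_def z)
        also have "\<dots> \<le> Re (H z)" using r(3)[of x] by (simp add: H_def zx dist_real_def)
        finally show "w (f z) \<le> Re (H z)" .
      qed (use S f in auto)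
      then show "w (f 0) \<le> integral {0..2 * pi} (\<lambda>t. g k (cis t)) / (2 * pi) + e"
        using schwarz_integral_0[OF gk] by (simp add: H_def)
    qed
    then show ?thesis by (simp add: field_simps)
  qed
  have ineq: "ennreal (2 * pi * w (f 0)) \<le> (\<integral>\<^sup>+ t \<in> {0..2 * pi}. ennreal (g k (cis t)) \<partial>lborel)" for k
  proof -
    have I: "((\<lambda>t. g k (cis t)) has_integral integral {0..2 * pi} (\<lambda>t. g k (cis t))) {0..2 * pi}"
      by (intro integrable_integral integrable_continuous_real continuous_on_subset[OF gc]) auto
    have "(\<integral>\<^sup>+ t \<in> {0..2 * pi}. ennreal (g k (cis t)) \<partial>lborel) = ennreal (integral {0..2 * pi} (\<lambda>t. g k (cis t)))"
      by (rule nn_integral_has_integral_lebesgue'[OF _ I]) (rule g0)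
    then show ?thesis using mean[of k] by (simp add: mult.commute ennreal_leI)
  qed
  have [measurable]: "(\<lambda>t. g k (cis t)) \<in> borel_measurable borel" for k
    by (rule borel_measurable_continuous_onI[OF gc])
  have lim: "(\<lambda>k. g k (cis t)) \<longlonglongrightarrow> w (f (cis t))" for t by (rule g(4)[OF cisX])
  have [measurable]: "(\<lambda>t. w (f (cis t))) \<in> borel_measurable borel"
    by (rule borel_measurable_LIMSEQ_real[OF lim]) measurable
  have "(\<lambda>k. \<integral>\<^sup>+ t \<in> {0..2 * pi}. ennreal (g k (cis t)) \<partial>lborel)
      \<longlonglongrightarrow> (\<integral>\<^sup>+ t \<in> {0..2 * pi}. ennreal (w (f (cis t))) \<partial>lborel)"
  proof (rule nn_integral_dominated_convergence[where w = "\<lambda>t. ennreal B * indicator {0..2 * pi} t"])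
    show "AE t in lborel. ennreal (g j (cis t)) * indicator {0..2 * pi} t \<le> ennreal B * indicator {0..2 * pi} t" for j
      using g(3)[OF cisX] by (intro always_eventually allI mult_right_mono ennreal_leI) auto
    show "(\<integral>\<^sup>+ t. ennreal B * indicator {0..2 * pi} t \<partial>lborel) < \<infinity>"
      by (simp add: nn_integral_cmult ennreal_mult_less_top)
    show "AE t in lborel. (\<lambda>k. ennreal (g k (cis t)) * indicator {0..2 * pi} t)
        \<longlonglongrightarrow> ennreal (w (f (cis t))) * indicator {0..2 * pi} t"
      using lim by (intro always_eventually allI) (auto simp: indicator_def intro!: tendsto_ennrealI)
  qed measurable
  then show ?thesis by (rule LIMSEQ_le_const) (use ineq in auto)
qed

section \<open>Area means\<close>

text \<open>An iterated integral, so that integrals along horizontal and vertical lines can be inserted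
  directly.\<close>
definition plane_integral :: "(complex \<Rightarrow> ennreal) \<Rightarrow> ennreal" where
  "plane_integral F = (\<integral>\<^sup>+ x. \<integral>\<^sup>+ y. F (Complex x y) \<partial>lborel \<partial>lborel)"

lemma measurable_Complex [measurable (raw)]:
  assumes [measurable]: "f \<in> borel_measurable M" "g \<in> borel_measurable M"
  shows "(\<lambda>x. Complex (f x) (g x)) \<in> borel_measurable M"
  unfolding Complex_eq by measurable

lemma plane_integral_swap:
  assumes [measurable]: "F \<in> borel_measurable borel"
  shows "plane_integral F = (\<integral>\<^sup>+ y. \<integral>\<^sup>+ x. F (Complex x y) \<partial>lborel \<partial>lborel)"
  unfolding plane_integral_def by (rule lborel_pair.Fubini') measurable

lemma nn_integral_lborel_shift:
  fixes F :: "real \<Rightarrow> ennreal"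
  assumes [measurable]: "F \<in> borel_measurable borel"
  shows "(\<integral>\<^sup>+ x. F (x + c) \<partial>lborel) = (\<integral>\<^sup>+ x. F x \<partial>lborel)"
  using nn_integral_real_affine[of F 1 c] by (simp add: add.commute)

lemma plane_integral_shear:
  assumes [measurable]: "F \<in> borel_measurable borel"
  shows "plane_integral (\<lambda>z. F (Complex (Re z + a * Im z) (Im z))) = plane_integral F"
    and "plane_integral (\<lambda>z. F (Complex (Re z) (Im z + a * Re z))) = plane_integral F"
proof -
  show "plane_integral (\<lambda>z. F (Complex (Re z + a * Im z) (Im z))) = plane_integral F"
    unfolding plane_integral_swap[OF assms]
    by (subst plane_integral_swap, measurable)
       (simp, intro nn_integral_cong nn_integral_lborel_shift[where F = "\<lambda>x. F (Complex x _)"], measurable)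
  show "plane_integral (\<lambda>z. F (Complex (Re z) (Im z + a * Re z))) = plane_integral F"
    unfolding plane_integral_def
    by (simp, intro nn_integral_cong nn_integral_lborel_shift[where F = "\<lambda>y. F (Complex _ y)"], measurable)
qed

text \<open>A rotation by an angle other than \<open>\<pi>\<close> is a product of three shears, horizontal, vertical and
  horizontal, and a shear is a translation on every line parallel to its axis.\<close>
lemma plane_integral_rotation:
  assumes [measurable]: "F \<in> borel_measurable borel" and t: "cos (t / 2) \<noteq> 0"
  shows "plane_integral (\<lambda>z. F (cis t * z)) = plane_integral F"
proof -
  define a where "a = - tan (t / 2)"
  define b where "b = sin t"
  have ab: "1 + a * b = cos t"
  proof -
    have "a * b = - (2 * sin (t / 2)^2)"
      using t sin_double[of "t / 2"] by (simp add: a_def b_def tan_def power2_eq_square)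
    then show ?thesis using cos_double_sin[of "t / 2"] by simp
  qed
  have a2: "a * (1 + cos t) = - sin t"
    using t cos_double_cos[of "t / 2"] sin_double[of "t / 2"] by (simp add: a_def tan_def power2_eq_square)
  define X Y where "X z = Complex (Re z + a * Im z) (Im z)" and "Y z = Complex (Re z) (Im z + b * Re z)" for z
  have [measurable]: "X \<in> borel_measurable borel" "Y \<in> borel_measurable borel"
    unfolding X_def Y_def by measurable
  have rot: "cis t * z = X (Y (X z))" for z
  proof -
    have "Im z + b * (Re z + a * Im z) = b * Re z + (1 + a * b) * Im z" by (simp add: algebra_simps)
    moreover have "Re z + a * Im z + a * (b * Re z + cos t * Im z) = (1 + a * b) * Re z + a * (1 + cos t) * Im z"
      by (simp add: algebra_simps)
    ultimately show ?thesis
      unfolding X_def Y_def by (simp only: complex.sel ab a2) (simp add: complex_eq_iff b_def)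
  qed
  have "plane_integral (\<lambda>z. F (X (Y (X z)))) = plane_integral (\<lambda>z. F (X (Y z)))"
    using plane_integral_shear(1)[of "\<lambda>z. F (X (Y z))" a] by (simp add: X_def)
  also have "\<dots> = plane_integral (\<lambda>z. F (X z))"
    using plane_integral_shear(2)[of "\<lambda>z. F (X z)" b] by (simp add: Y_def)
  also have "\<dots> = plane_integral F"
    using plane_integral_shear(1)[of F a] by (simp add: X_def)
  finally show ?thesis by (simp add: rot)
qed

lemma plane_integral_cmult:
  assumes [measurable]: "F \<in> borel_measurable borel"
  shows "plane_integral (\<lambda>z. c * F z) = c * plane_integral F"
  unfolding plane_integral_def by (simp add: nn_integral_cmult)

lemma plane_integral_mono:
  assumes "\<And>z. F z \<le> G z"
  shows "plane_integral F \<le> plane_integral G"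
  unfolding plane_integral_def by (intro nn_integral_mono assms)

lemma plane_integral_nn_integral_swap:
  fixes F :: "real \<Rightarrow> complex \<Rightarrow> ennreal"
  assumes [measurable]: "(\<lambda>(t, z). F t z) \<in> borel_measurable (borel \<Otimes>\<^sub>M borel)"
  shows "plane_integral (\<lambda>z. \<integral>\<^sup>+ t. F t z \<partial>lborel) = (\<integral>\<^sup>+ t. plane_integral (F t) \<partial>lborel)"
proof -
  have "plane_integral (\<lambda>z. \<integral>\<^sup>+ t. F t z \<partial>lborel)
      = (\<integral>\<^sup>+ x. \<integral>\<^sup>+ t. \<integral>\<^sup>+ y. F t (Complex x y) \<partial>lborel \<partial>lborel \<partial>lborel)"
    unfolding plane_integral_def by (intro nn_integral_cong lborel_pair.Fubini') measurable
  also have "\<dots> = (\<integral>\<^sup>+ t. plane_integral (F t) \<partial>lborel)"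
    unfolding plane_integral_def by (intro lborel_pair.Fubini') measurable
  finally show ?thesis .
qed

text \<open>For each \<open>\<zeta>\<close> in the ball the disc \<open>u \<mapsto> z + u * \<zeta>\<close> gives a mean value inequality; integrating over \<open>\<zeta>\<close> and
  using invariance under rotation for every fixed angle avoids polar coordinates.\<close>
lemma nonneg_subharmonic_area_mean:
  assumes w: "nonneg_subharmonic w \<Omega>" and "cball z \<rho> \<subseteq> \<Omega>" "0 < \<rho>"
  shows "ennreal (w z) * plane_integral (indicator (ball 0 \<rho>))
           \<le> plane_integral (\<lambda>\<zeta>. ennreal (w (z + \<zeta>)) * indicator (ball 0 \<rho>) \<zeta>)"
proof -
  note D = nonneg_subharmonicD[OF w]
  note [measurable] = nonneg_subharmonic_measurable[OF w]
  have [measurable]: "ball (0::complex) \<rho> \<in> sets borel" by simp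
  have [measurable]: "cis \<in> borel_measurable borel"
    by (intro borel_measurable_continuous_onI continuous_intros)
  define J where "J = plane_integral (\<lambda>\<zeta>. ennreal (w (z + \<zeta>)) * indicator (ball 0 \<rho>) \<zeta>)"
  have disc: "ennreal (2 * pi * w z) \<le> (\<integral>\<^sup>+ t \<in> {0..2 * pi}. ennreal (w (z + cis t * \<zeta>)) \<partial>lborel)"
    if "\<zeta> \<in> ball 0 \<rho>" for \<zeta>
  proof (cases "\<zeta> = 0")
    case True
    then show ?thesis using D(2)[of z] by (simp add: nn_integral_cmult ennreal_mult' mult.commute)
  next
    case False
    have "((\<lambda>u. z + u * \<zeta>) has_field_derivative \<zeta>) (at 0)"
      by (auto intro!: derivative_eq_intros)
    then have d: "deriv (\<lambda>u. z + u * \<zeta>) 0 \<noteq> 0" using False by (simp add: DERIV_imp_deriv)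
    have "(\<lambda>u. z + u * \<zeta>) ` cball 0 1 \<subseteq> cball z \<rho>"
    proof (clarsimp simp: dist_norm norm_mult)
      fix u :: complex assume "norm u \<le> 1"
      then have "norm u * norm \<zeta> \<le> 1 * norm \<zeta>" by (intro mult_right_mono) auto
      then show "norm u * norm \<zeta> \<le> \<rho>" using that by simp
    qed
    then have "(\<lambda>u. z + u * \<zeta>) ` cball 0 1 \<subseteq> \<Omega>" using assms(2) by blast
    from nonneg_subharmonic_holomorphic_disc[OF w open_UNIV _ _ this d]
    show ?thesis by (simp add: holomorphic_intros)
  qed
  have "ennreal (2 * pi) * (ennreal (w z) * plane_integral (indicator (ball 0 \<rho>)))
      = plane_integral (\<lambda>\<zeta>. ennreal (2 * pi * w z) * indicator (ball 0 \<rho>) \<zeta>)"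
    using D(2)[of z] by (subst plane_integral_cmult) (auto simp: ennreal_mult' mult.assoc)
  also have "\<dots> \<le> plane_integral (\<lambda>\<zeta>. \<integral>\<^sup>+ t. ennreal (w (z + cis t * \<zeta>)) * indicator {0..2 * pi} t * indicator (ball 0 \<rho>) \<zeta> \<partial>lborel)"
    using disc by (intro plane_integral_mono) (auto simp: indicator_def)
  also have "\<dots> = (\<integral>\<^sup>+ t. plane_integral (\<lambda>\<zeta>. ennreal (w (z + cis t * \<zeta>)) * indicator {0..2 * pi} t * indicator (ball 0 \<rho>) \<zeta>) \<partial>lborel)"
    by (rule plane_integral_nn_integral_swap) measurable
  also have "\<dots> = (\<integral>\<^sup>+ t. J * indicator {0..2 * pi} t \<partial>lborel)"
  proof (rule nn_integral_cong_AE)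
    have "AE t in lborel. t \<noteq> pi" by (rule AE_lborel_singleton)
    then show "AE t in lborel. plane_integral (\<lambda>\<zeta>. ennreal (w (z + cis t * \<zeta>)) * indicator {0..2 * pi} t * indicator (ball 0 \<rho>) \<zeta>)
        = J * indicator {0..2 * pi} t"
    proof eventually_elim
      case (elim t)
      show ?case
      proof (cases "t \<in> {0..2 * pi}")
        case True
        have c: "cos (t / 2) \<noteq> 0"
        proof
          assume "cos (t / 2) = 0"
          then have eq: "cos (t / 2) = cos (pi / 2)" by simp
          have "t / 2 = pi / 2"
          proof (rule cos_inj_pi)
            show "cos (t / 2) = cos (pi / 2)" by (fact eq)
          qed (use True in simp_all)
          then show False using elim by simp
        qed
        have "plane_integral (\<lambda>\<zeta>. ennreal (w (z + cis t * \<zeta>)) * indicator {0..2 * pi} t * indicator (ball 0 \<rho>) \<zeta>)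
          = plane_integral (\<lambda>\<zeta>. ennreal (w (z + cis t * \<zeta>)) * indicator (ball 0 \<rho>) (cis t * \<zeta>))"
          using True by (intro arg_cong[where f = plane_integral]) (auto simp: fun_eq_iff indicator_def norm_mult)
        also have "\<dots> = J"
          unfolding J_def by (rule plane_integral_rotation[OF _ c, of "\<lambda>\<zeta>. ennreal (w (z + \<zeta>)) * indicator (ball 0 \<rho>) \<zeta>"]) measurable
        finally show ?thesis using True by simp
      qed (simp add: plane_integral_def)
    qed
  qed
  also have "\<dots> = ennreal (2 * pi) * J"
    by (simp add: nn_integral_cmult mult.commute)
  finally show ?thesis
    unfolding J_def[symmetric] by (subst (asm) ennreal_mult_le_mult_iff) auto
qed

text \<open>The ball of radius \<open>\<rho>\<close> contains a square of area \<open>\<rho>^2\<close> and lies in a strip of height \<open>2 * \<rho>\<close>, on each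
  horizontal line of which the integral is at most \<open>C\<close>.\<close>
lemma nonneg_subharmonic_bound_from_horizontal:
  assumes w: "nonneg_subharmonic w \<Omega>" and "cball z \<rho> \<subseteq> \<Omega>" "0 < \<rho>" "0 \<le> C"
    and hor: "\<And>y. \<bar>y - Im z\<bar> < \<rho> \<Longrightarrow>
        (\<integral>\<^sup>+ x \<in> {Re z - \<rho>..Re z + \<rho>}. ennreal (w (Complex x y)) \<partial>lborel) \<le> ennreal C"
  shows "w z \<le> 2 * C / \<rho>"
proof -
  note D = nonneg_subharmonicD[OF w]
  note [measurable] = nonneg_subharmonic_measurable[OF w]
  have [measurable]: "ball (0::complex) \<rho> \<in> sets borel" by simp
  have "ennreal (\<rho>^2) = (\<integral>\<^sup>+ x. \<integral>\<^sup>+ y. indicator {-\<rho>/2..\<rho>/2} x * indicator {-\<rho>/2..\<rho>/2} y \<partial>lborel \<partial>lborel)"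
    using assms(3) by (simp add: nn_integral_cmult nn_integral_multc power2_eq_square ennreal_mult')
  also have "\<dots> \<le> plane_integral (indicator (ball 0 \<rho>))"
    unfolding plane_integral_def
  proof (intro nn_integral_mono)
    fix x y :: real
    show "indicator {-\<rho>/2..\<rho>/2} x * indicator {-\<rho>/2..\<rho>/2} y \<le> (indicator (ball 0 \<rho>) (Complex x y) :: ennreal)"
    proof (cases "x \<in> {-\<rho>/2..\<rho>/2} \<and> y \<in> {-\<rho>/2..\<rho>/2}")
      case True
      then have "x^2 \<le> (\<rho>/2)^2" "y^2 \<le> (\<rho>/2)^2" by (auto intro!: power2_le_iff_abs_le[THEN iffD2])
      then have "(norm (Complex x y))^2 \<le> \<rho>^2 / 2" by (simp add: cmod_power2 power_divide)
      also have "\<dots> < \<rho>^2" using assms(3) by simp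
      finally have "norm (Complex x y) < \<rho>" using assms(3) by (simp add: power2_less_imp_less)
      then show ?thesis by (auto simp: indicator_def)
    qed (auto simp: indicator_def)
  qed
  finally have lower: "ennreal (\<rho>^2) \<le> plane_integral (indicator (ball 0 \<rho>))" .
  have "ennreal (w z * \<rho>^2) = ennreal (w z) * ennreal (\<rho>^2)" using D(2) by (simp add: ennreal_mult')
  also have "\<dots> \<le> ennreal (w z) * plane_integral (indicator (ball 0 \<rho>))" using lower by (intro mult_left_mono) auto
  also have "\<dots> \<le> plane_integral (\<lambda>\<zeta>. ennreal (w (z + \<zeta>)) * indicator (ball 0 \<rho>) \<zeta>)"
    by (rule nonneg_subharmonic_area_mean[OF w assms(2,3)])
  also have "\<dots> = (\<integral>\<^sup>+ y. \<integral>\<^sup>+ x. ennreal (w (z + Complex x y)) * indicator (ball 0 \<rho>) (Complex x y) \<partial>lborel \<partial>lborel)"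
    by (rule plane_integral_swap) measurable
  also have "\<dots> \<le> (\<integral>\<^sup>+ y. ennreal C * indicator {-\<rho>..\<rho>} y \<partial>lborel)"
  proof (rule nn_integral_mono)
    fix y :: real
    show "(\<integral>\<^sup>+ x. ennreal (w (z + Complex x y)) * indicator (ball 0 \<rho>) (Complex x y) \<partial>lborel) \<le> ennreal C * indicator {-\<rho>..\<rho>} y"
    proof (cases "\<bar>y\<bar> < \<rho>")
      case True
      have "(\<integral>\<^sup>+ x. ennreal (w (z + Complex x y)) * indicator (ball 0 \<rho>) (Complex x y) \<partial>lborel)
        \<le> (\<integral>\<^sup>+ x. ennreal (w (Complex (x + Re z) (Im z + y))) * indicator {Re z - \<rho>..Re z + \<rho>} (x + Re z) \<partial>lborel)"
      proof (rule nn_integral_mono)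
        fix x :: real
        have "z + Complex x y = Complex (x + Re z) (Im z + y)" by (simp add: complex_eq_iff)
        moreover have "\<bar>x\<bar> \<le> \<rho>" if "Complex x y \<in> ball 0 \<rho>"
          using abs_Re_le_cmod[of "Complex x y"] that by simp
        ultimately show "ennreal (w (z + Complex x y)) * indicator (ball 0 \<rho>) (Complex x y)
          \<le> ennreal (w (Complex (x + Re z) (Im z + y))) * indicator {Re z - \<rho>..Re z + \<rho>} (x + Re z)"
          by (auto simp: indicator_def abs_le_iff)
      qed
      also have "\<dots> = (\<integral>\<^sup>+ x \<in> {Re z - \<rho>..Re z + \<rho>}. ennreal (w (Complex x (Im z + y))) \<partial>lborel)"
        by (rule nn_integral_lborel_shift[where F = "\<lambda>x. ennreal (w (Complex x (Im z + y))) * indicator {Re z - \<rho>..Re z + \<rho>} x"]) measurable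
      also have "\<dots> \<le> ennreal C" by (rule hor) (use True in simp)
      finally have "(\<integral>\<^sup>+ x. ennreal (w (z + Complex x y)) * indicator (ball 0 \<rho>) (Complex x y) \<partial>lborel) \<le> ennreal C" .
      moreover have "y \<in> {-\<rho>..\<rho>}" using True by auto
      ultimately show ?thesis by simp
    next
      case False
      have "Complex x y \<notin> ball 0 \<rho>" for x
        using abs_Im_le_cmod[of "Complex x y"] False by simp
      then show ?thesis by simp
    qed
  qed
  also have "\<dots> = ennreal (C * (2 * \<rho>))"
    using assms(3,4) by (simp add: nn_integral_cmult ennreal_mult')
  finally have "w z * \<rho>^2 \<le> C * (2 * \<rho>)" using assms by (subst (asm) ennreal_le_iff) auto
  then show ?thesis using assms(3) by (simp add: power2_eq_square field_simps)
qed

section \<open>The inverse distribution function of a measure of class A\<close>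

context
  fixes \<nu> :: "real measure" and a b :: real
  assumes A: "\<nu> \<in> class_A a b"
begin

private abbreviation "F \<equiv> interval_dist_fun \<nu> a"
private abbreviation "\<mu> \<equiv> extended_inverse \<nu> a b"

lemma class_AD:
  shows "a < b" "prob_space \<nu>" "sets \<nu> = sets borel" "emeasure \<nu> {a..b} = 1" "F a = 0"
    "strict_mono_on {a..b} F" "continuous_on {a..b} F"
  using A by (auto simp: class_A_def)

lemma dist_fun_right: "F b = 1"
  using class_AD(4) by (simp add: interval_dist_fun_def measure_def)

lemma dist_fun_image: "F ` {a..b} = {0..1}"
proof
  show "F ` {a..b} \<subseteq> {0..1}"
    using class_AD(1,5) dist_fun_right strict_mono_on_leD[OF class_AD(6), of a]
      strict_mono_on_leD[OF class_AD(6), of _ b] by fastforce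
  show "{0..1} \<subseteq> F ` {a..b}"
  proof
    fix t :: real assume "t \<in> {0..1}"
    then obtain x where "a \<le> x" "x \<le> b" "F x = t"
      using IVT'[of F a t b] class_AD(1,5,7) dist_fun_right by auto
    then show "t \<in> F ` {a..b}" by auto
  qed
qed

lemma inverse_dist_fun:
  assumes "t \<in> {0..1}"
  shows "\<mu> t \<in> {a..b}" "F (\<mu> t) = t"
proof -
  have inj: "inj_on F {a..b}" by (rule strict_mono_on_imp_inj_on[OF class_AD(6)])
  have m: "\<mu> t = the_inv_into {a..b} F t" using assms by (simp add: extended_inverse_def)
  show "\<mu> t \<in> {a..b}" unfolding m using the_inv_into_into[OF inj, of t "{a..b}"] assms dist_fun_image by auto
  show "F (\<mu> t) = t" unfolding m using f_the_inv_into_f[OF inj, of t] assms dist_fun_image by auto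
qed

lemma dist_fun_inverse:
  assumes "x \<in> {a..b}"
  shows "\<mu> (F x) = x"
proof -
  have "F x \<in> {0..1}" using assms dist_fun_image by blast
  then show ?thesis
    using the_inv_into_f_f[OF strict_mono_on_imp_inj_on[OF class_AD(6)] assms]
    by (simp add: extended_inverse_def)
qed

lemma inverse_le_iff:
  assumes "t \<in> {0..1}" "x \<in> {a..b}"
  shows "\<mu> t \<le> x \<longleftrightarrow> t \<le> F x"
  using strict_mono_on_less_eq[OF class_AD(6) inverse_dist_fun(1)[OF assms(1)] assms(2)]
    inverse_dist_fun(2)[OF assms(1)] by simp

lemma inverse_strict_mono:
  assumes "0 \<le> s" "s < t" "t \<le> 1"
  shows "\<mu> s < \<mu> t"
  using inverse_le_iff[of t "\<mu> s"] inverse_dist_fun[of s] assms by (auto simp: not_le[symmetric])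

lemma inverse_mono: "mono \<mu>"
proof
  fix s t :: real assume "s \<le> t"
  consider "s = t" | "0 \<le> s" "s < t" "t \<le> 1" | "s < 0" | "1 < t" using \<open>s \<le> t\<close> by linarith
  then show "\<mu> s \<le> \<mu> t"
  proof cases
    case 2
    then show ?thesis using inverse_strict_mono by fastforce
  next
    case 3
    then show ?thesis using inverse_dist_fun(1)[of t] class_AD(1)
      by (cases "t < 0"; cases "t > 1") (auto simp: extended_inverse_def)
  next
    case 4
    then show ?thesis using inverse_dist_fun(1)[of s] class_AD(1)
      by (cases "s < 0"; cases "s > 1") (auto simp: extended_inverse_def)
  qed simp
qed

lemma inverse_continuous: "continuous_on {0..1} \<mu>"
  using continuous_on_inv[of "{a..b}" F \<mu>] class_AD(7) dist_fun_inverse dist_fun_image by auto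

lemma inverse_interior:
  assumes "0 < t" "t < 1"
  shows "a < \<mu> t" "\<mu> t < b"
proof -
  have "\<mu> 0 \<ge> a" "\<mu> 1 \<le> b" using inverse_dist_fun(1)[of 0] inverse_dist_fun(1)[of 1] by auto
  then show "a < \<mu> t" "\<mu> t < b"
    using inverse_strict_mono[of 0 t] inverse_strict_mono[of t 1] assms by auto
qed

lemma inverse_surj:
  assumes "a < x" "x < b"
  obtains t where "0 < t" "t < 1" "\<mu> t = x"
proof
  have x: "x \<in> {a..b}" using assms by simp
  show "\<mu> (F x) = x" by (rule dist_fun_inverse[OF x])
  show "0 < F x" using strict_mono_onD[OF class_AD(6), of a x] class_AD(1,5) assms by auto
  show "F x < 1" using strict_mono_onD[OF class_AD(6), of x b] class_AD(1) dist_fun_right assms by auto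
qed

lemma inverse_measurable: "\<mu> \<in> borel_measurable borel"
  by (rule borel_measurable_mono[OF inverse_mono])

text \<open>The two measures have the same distribution function: \<open>\<mu> t \<le> x\<close> holds exactly when \<open>t \<le> F x\<close>.\<close>
lemma distr_inverse: "distr (uniform_measure lborel {0..1}) borel \<mu> = \<nu>"
proof (rule cdf_unique)
  interpret U: prob_space "uniform_measure lborel {0..1::real}"
    by (rule prob_space_uniform_measure) auto
  interpret N: prob_space \<nu> by (rule class_AD(2))
  note [measurable] = inverse_measurable
  show r1: "real_distribution (distr (uniform_measure lborel {0..1}) borel \<mu>)"
    by (rule U.real_distribution_distr) measurable
  show "real_distribution \<nu>"
    using class_AD(2,3) by (simp add: real_distribution_def real_distribution_axioms_def)
  have sp: "space \<nu> = UNIV" using sets_eq_imp_space_eq[OF class_AD(3)] by simp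
  have [measurable_cong]: "sets \<nu> = sets borel" by (rule class_AD(3))
  have full: "AE y in \<nu>. y \<in> {a..b}"
    using N.AE_prob_1[of "{a..b}"] class_AD(4) by (simp add: measure_def)
  show "cdf (distr (uniform_measure lborel {0..1}) borel \<mu>) = cdf \<nu>"
  proof
    fix x
    have "cdf (distr (uniform_measure lborel {0..1}) borel \<mu>) x
        = measure (uniform_measure lborel {0..1}) {t. \<mu> t \<le> x}"
      unfolding cdf_def2 by (subst measure_distr) (auto simp: vimage_def)
    also have "\<dots> = measure lborel ({0..1} \<inter> {t. \<mu> t \<le> x})"
      by (simp add: measure_uniform_measure)
    finally have L: "cdf (distr (uniform_measure lborel {0..1}) borel \<mu>) x = measure lborel ({0..1} \<inter> {t. \<mu> t \<le> x})" .
    consider "x < a" | "x \<in> {a..b}" | "b < x" by fastforce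
    then show "cdf (distr (uniform_measure lborel {0..1}) borel \<mu>) x = cdf \<nu> x"
    proof cases
      case 1
      have "{0..1} \<inter> {t. \<mu> t \<le> x} = {}" using inverse_dist_fun(1) 1 by fastforce
      moreover have "measure \<nu> {..x} = 0"
        using full 1 by (subst N.prob_eq_0) (auto simp: sp elim!: eventually_mono)
      ultimately show ?thesis unfolding L unfolding cdf_def2 by simp
    next
      case 2
      then have Fx: "F x \<in> {0..1}" using dist_fun_image by blast
      have "{0..1} \<inter> {t. \<mu> t \<le> x} = {0..F x}" using inverse_le_iff[OF _ 2] Fx by auto
      moreover have "measure \<nu> {..x} = F x"
        unfolding interval_dist_fun_def
        by (rule measure_eq_AE) (use full 2 in \<open>auto elim!: eventually_mono\<close>)
      ultimately show ?thesis unfolding L unfolding cdf_def2 using Fx by simp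
    next
      case 3
      have "{0..1} \<inter> {t. \<mu> t \<le> x} = {0..1}" using inverse_dist_fun(1) 3 by fastforce
      moreover have "measure \<nu> {..x} = 1"
      proof (subst N.prob_eq_1)
        show "AE y in \<nu>. y \<in> {..x}" using full by eventually_elim (use 3 in auto)
      qed measurable
      ultimately show ?thesis unfolding L unfolding cdf_def2 by simp
    qed
  qed
qed

lemma nn_integral_inverse:
  assumes [measurable]: "h \<in> borel_measurable borel"
  shows "(\<integral>\<^sup>+ t \<in> {0..1}. h (\<mu> t) \<partial>lborel) = (\<integral>\<^sup>+ y. h y \<partial>\<nu>)"
proof -
  note [measurable] = inverse_measurable
  have "(\<integral>\<^sup>+ y. h y \<partial>\<nu>) = (\<integral>\<^sup>+ y. h y \<partial>distr (uniform_measure lborel {0..1}) borel \<mu>)"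
    by (simp only: distr_inverse)
  also have "\<dots> = (\<integral>\<^sup>+ t. h (\<mu> t) \<partial>uniform_measure lborel {0..1})"
    by (rule nn_integral_distr) measurable
  also have "\<dots> = (\<integral>\<^sup>+ t \<in> {0..1}. h (\<mu> t) \<partial>lborel)"
    by (subst nn_integral_uniform_measure) (auto simp: divide_ennreal_def)
  finally show ?thesis ..
qed

text \<open>The limit in the definition of class A, as a bound for all sufficiently short intervals that is uniform
  in the centre.\<close>
lemma inverse_dini_small:
  assumes "0 < e"
  obtains \<delta>0 where "0 < \<delta>0" "\<And>\<delta> x. 0 < \<delta> \<Longrightarrow> \<delta> < \<delta>0 \<Longrightarrow>
    (\<integral>\<^sup>+ t \<in> {0<..<\<delta>}. ennreal ((\<mu> (x + t) - \<mu> (x - t)) / t) \<partial>lborel) \<le> ennreal e"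
proof -
  have "((\<lambda>\<delta>. SUP x. \<integral>\<^sup>+ t \<in> {0<..<\<delta>}. ennreal ((\<mu> (x + t) - \<mu> (x - t)) / t) \<partial>lborel) \<longlongrightarrow> 0) (at_right 0)"
    using A by (simp add: class_A_def)
  then have "\<forall>\<^sub>F \<delta> in at_right 0. (SUP x. \<integral>\<^sup>+ t \<in> {0<..<\<delta>}. ennreal ((\<mu> (x + t) - \<mu> (x - t)) / t) \<partial>lborel) < ennreal e"
    by (rule order_tendstoD) (use assms in simp)
  then obtain d where d: "0 < d" "\<And>\<delta>. 0 < \<delta> \<Longrightarrow> \<delta> < d \<Longrightarrow>
      (SUP x. \<integral>\<^sup>+ t \<in> {0<..<\<delta>}. ennreal ((\<mu> (x + t) - \<mu> (x - t)) / t) \<partial>lborel) < ennreal e"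
    unfolding eventually_at_right_field by blast
  show ?thesis
  proof (rule that[OF d(1)])
    fix \<delta> x :: real assume "0 < \<delta>" "\<delta> < d"
    then show "(\<integral>\<^sup>+ t \<in> {0<..<\<delta>}. ennreal ((\<mu> (x + t) - \<mu> (x - t)) / t) \<partial>lborel) \<le> ennreal e"
      using d(2)[of \<delta>] by (meson SUP_upper UNIV_I le_less_trans less_imp_le)
  qed
qed

end

section \<open>The positive part of a subharmonic function\<close>

definition pos_part :: "(complex \<Rightarrow> ereal) \<Rightarrow> complex set \<Rightarrow> complex \<Rightarrow> real" where
  "pos_part u \<Omega> z = (if z \<in> \<Omega> then real_of_ereal (max (u z) 0) else 0)"

lemma pos_part_eq:
  assumes "subharmonic_on u \<Omega>" "z \<in> \<Omega>"
  shows "ereal (pos_part u \<Omega> z) = max (u z) 0" "e2ennreal (max (u z) 0) = ennreal (pos_part u \<Omega> z)"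
    "e2ennreal (u z) = ennreal (pos_part u \<Omega> z)"
proof -
  have "max (u z) 0 \<noteq> \<infinity>" using assms by (auto simp: subharmonic_on_def max_def)
  then show 1: "ereal (pos_part u \<Omega> z) = max (u z) 0"
    using assms(2) by (auto simp: pos_part_def ereal_real max_def)
  show 2: "e2ennreal (max (u z) 0) = ennreal (pos_part u \<Omega> z)" by (simp flip: 1)
  show "e2ennreal (u z) = ennreal (pos_part u \<Omega> z)"
    unfolding 2[symmetric] by (cases "u z \<le> 0") (auto simp: max_def e2ennreal_neg)
qed

text \<open>Where \<open>u\<close> is positive, the circle mean of \<open>u\<close> is at most that of its positive part, because the negative
  part is only subtracted.\<close>
lemma pos_part_nonneg_subharmonic:
  assumes u: "subharmonic_on u \<Omega>"
  shows "nonneg_subharmonic (pos_part u \<Omega>) \<Omega>"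
  unfolding nonneg_subharmonic_def
proof (intro conjI allI impI)
  show op: "open \<Omega>" using u by (simp add: subharmonic_on_def)
  show "0 \<le> pos_part u \<Omega> z" for z by (simp add: pos_part_def real_of_ereal_pos)
  show "pos_part u \<Omega> z = 0" if "z \<notin> \<Omega>" for z using that by (simp add: pos_part_def)
  show "usc_on \<Omega> (pos_part u \<Omega>)"
    unfolding usc_on_def
  proof (intro ballI allI impI)
    fix z c assume z: "z \<in> \<Omega>" and c: "pos_part u \<Omega> z < c"
    have "0 \<le> pos_part u \<Omega> z" by (simp add: pos_part_def real_of_ereal_pos)
    then have c0: "0 < c" using c by linarith
    have "ereal (pos_part u \<Omega> z) < ereal c" using c by simp
    then have uz: "u z < ereal c" unfolding pos_part_eq(1)[OF u z] by simp
    have "openin (top_of_set \<Omega>) {z \<in> \<Omega>. u z < ereal c}" using u by (simp add: subharmonic_on_def)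
    then have o: "open {z \<in> \<Omega>. u z < ereal c}" using op openin_open_trans by blast
    have "pos_part u \<Omega> y < c" if "y \<in> {z \<in> \<Omega>. u z < ereal c}" for y
    proof -
      have "ereal (pos_part u \<Omega> y) < ereal c" using that c0 by (subst pos_part_eq(1)[OF u]) auto
      then show ?thesis by simp
    qed
    then show "\<forall>\<^sub>F y in at z within \<Omega>. pos_part u \<Omega> y < c"
      unfolding eventually_at_topological using o z uz by blast
  qed
  fix z r assume r: "0 < r" "cball z r \<subseteq> \<Omega>"
  have z: "z \<in> \<Omega>" using r by auto
  have in\<Omega>: "z + of_real r * cis t \<in> \<Omega>" for t
    using r by (auto simp: dist_norm norm_mult intro!: subsetD[OF r(2)])
  define P where "P = (\<integral>\<^sup>+ t \<in> {0..2 * pi}. e2ennreal (u (z + of_real r * cis t)) \<partial>lborel)"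
  define N where "N = (\<integral>\<^sup>+ t \<in> {0..2 * pi}. e2ennreal (- u (z + of_real r * cis t)) \<partial>lborel)"
  have P: "P = (\<integral>\<^sup>+ t \<in> {0..2 * pi}. ennreal (pos_part u \<Omega> (z + of_real r * cis t)) \<partial>lborel)"
    unfolding P_def by (simp add: pos_part_eq(3)[OF u in\<Omega>])
  show "ennreal (2 * pi * pos_part u \<Omega> z)
      \<le> (\<integral>\<^sup>+ t \<in> {0..2 * pi}. ennreal (pos_part u \<Omega> (z + of_real r * cis t)) \<partial>lborel)"
  proof (cases "u z \<le> 0")
    case True
    then have "pos_part u \<Omega> z = 0" by (simp add: pos_part_def max_def)
    then show ?thesis by simp
  next
    case False
    have "u z \<le> ereal (1 / (2 * pi)) * (enn2ereal P - enn2ereal N)"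
      using u r by (simp add: subharmonic_on_def circle_mean_def P_def N_def)
    also have "\<dots> \<le> ereal (1 / (2 * pi)) * enn2ereal P"
    proof (rule ereal_mult_left_mono)
      have "enn2ereal P - enn2ereal N \<le> enn2ereal P - 0"
        by (rule ereal_minus_mono) auto
      then show "enn2ereal P - enn2ereal N \<le> enn2ereal P" by simp
    qed simp
    finally have "e2ennreal (u z) \<le> e2ennreal (ereal (1 / (2 * pi)) * enn2ereal P)"
      by (rule e2ennreal_mono)
    also have "ereal (1 / (2 * pi)) * enn2ereal P = enn2ereal (ennreal (1 / (2 * pi)) * P)"
      by (simp add: times_ennreal.rep_eq enn2ereal_ennreal)
    finally have "ennreal (pos_part u \<Omega> z) \<le> ennreal (1 / (2 * pi)) * P"
      using pos_part_eq(3)[OF u z] by simp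
    then have "ennreal (2 * pi) * ennreal (pos_part u \<Omega> z) \<le> ennreal (2 * pi) * (ennreal (1 / (2 * pi)) * P)"
      by (intro mult_left_mono) auto
    also have "\<dots> = P" by (simp add: mult.assoc[symmetric] flip: ennreal_mult')
    finally show ?thesis unfolding P by (simp add: ennreal_mult')
  qed
qed

section \<open>Discs whose boundary heights follow the measure\<close>

text \<open>In terms of the angle this is the even, \<open>2\<pi>\<close>-periodic function that runs through the values of \<open>\<mu>\<close> on
  \<open>[c, c + \<delta>]\<close> on the upper half circle and back on the lower one: \<open>arccos (cos t)\<close> is the distance from \<open>t\<close>
  to the nearest multiple of \<open>2\<pi>\<close>. Folding avoids the jump that a periodic continuation would have.\<close>
definition folded_boundary :: "(real \<Rightarrow> real) \<Rightarrow> real \<Rightarrow> real \<Rightarrow> complex \<Rightarrow> real" where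
  "folded_boundary \<mu> c \<delta> z = \<mu> (c + \<delta> * arccos (Re z) / pi)"

lemma arccos_cos_between:
  assumes "0 \<le> x" "x \<le> pi" "0 \<le> s" "s \<le> pi"
  shows "arccos (cos (x + s)) \<in> {x - s..x + s}" "arccos (cos (x - s)) \<in> {x - s..x + s}"
proof -
  show "arccos (cos (x + s)) \<in> {x - s..x + s}"
  proof (cases "x + s \<le> pi")
    case True
    then show ?thesis using assms by (simp add: arccos_cos)
  next
    case False
    have "cos (x + s) = cos (2 * pi - (x + s))" by (simp add: cos_diff)
    moreover have "arccos (cos (2 * pi - (x + s))) = 2 * pi - (x + s)"
      using False assms by (intro arccos_cos) auto
    ultimately show ?thesis using False assms by simp
  qed
  have "cos (x - s) = cos \<bar>x - s\<bar>" by simp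
  moreover have "arccos (cos \<bar>x - s\<bar>) = \<bar>x - s\<bar>" using assms by (intro arccos_cos) auto
  ultimately show "arccos (cos (x - s)) \<in> {x - s..x + s}" using assms by auto
qed

text \<open>For \<open>x\<close> and \<open>s\<close> between 0 and \<open>\<pi>\<close>, folding moves both \<open>x + s\<close> and \<open>x - s\<close> into the interval from
  \<open>x - s\<close> to \<open>x + s\<close>, so by monotonicity the increments of the folded function are dominated by those of
  \<open>\<mu>\<close> itself. Any other \<open>x\<close> can be replaced by \<open>arccos (cos x)\<close>, which at most exchanges the two points.\<close>
lemma folded_boundary_diff:
  assumes "mono \<mu>" "0 \<le> \<delta>" "0 \<le> s" "s \<le> pi"
  shows "\<bar>folded_boundary \<mu> c \<delta> (cis (x + s)) - folded_boundary \<mu> c \<delta> (cis (x - s))\<bar>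
    \<le> \<mu> (c + \<delta> * arccos (cos x) / pi + \<delta> * s / pi) - \<mu> (c + \<delta> * arccos (cos x) / pi - \<delta> * s / pi)"
proof -
  define x' where "x' = arccos (cos x)"
  have x': "0 \<le> x'" "x' \<le> pi" "cos x' = cos x" by (auto simp: x'_def arccos_lbound arccos_ubound)
  have "sin x' = \<bar>sin x\<bar>"
    by (simp add: x'_def sin_arccos sin_squared_eq[symmetric] abs_cos_le_one abs_le_D1 abs_le_D2)
  then have swap: "cos (x + s) = cos (x' + s) \<and> cos (x - s) = cos (x' - s) \<or>
     cos (x + s) = cos (x' - s) \<and> cos (x - s) = cos (x' + s)"
    by (auto simp: cos_add cos_diff x'(3) abs_if split: if_splits)
  define T where "T v = c + \<delta> * arccos v / pi" for v
  have T: "T v \<in> {T (cos x) - \<delta> * s / pi..T (cos x) + \<delta> * s / pi}" if "arccos v \<in> {x' - s..x' + s}" for v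
  proof -
    have "\<delta> * (x' - s) / pi \<le> \<delta> * arccos v / pi" "\<delta> * arccos v / pi \<le> \<delta> * (x' + s) / pi"
      using that assms(2) by (auto intro!: divide_right_mono mult_left_mono)
    then show ?thesis by (simp add: T_def x'_def[symmetric] algebra_simps diff_divide_distrib add_divide_distrib)
  qed
  note b = arccos_cos_between[OF x'(1,2) assms(3,4)]
  have "T (cos (x + s)) \<in> {T (cos x) - \<delta> * s / pi..T (cos x) + \<delta> * s / pi}"
    "T (cos (x - s)) \<in> {T (cos x) - \<delta> * s / pi..T (cos x) + \<delta> * s / pi}"
    using swap T[OF b(1)] T[OF b(2)] by auto
  then have "\<mu> (T (cos (x + s))) \<in> {\<mu> (T (cos x) - \<delta> * s / pi)..\<mu> (T (cos x) + \<delta> * s / pi)}"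
    "\<mu> (T (cos (x - s))) \<in> {\<mu> (T (cos x) - \<delta> * s / pi)..\<mu> (T (cos x) + \<delta> * s / pi)}"
    using monoD[OF assms(1)] by auto
  then show ?thesis by (auto simp: folded_boundary_def T_def abs_le_iff)
qed

lemma folded_boundary_dini:
  assumes "mono \<mu>" "0 < \<delta>"
    and bound: "\<And>y. (\<integral>\<^sup>+ t \<in> {0<..<\<delta>}. ennreal ((\<mu> (y + t) - \<mu> (y - t)) / t) \<partial>lborel) \<le> ennreal e"
  shows "(\<integral>\<^sup>+ s \<in> {0<..<pi}. ennreal (\<bar>folded_boundary \<mu> c \<delta> (cis (x + s)) - folded_boundary \<mu> c \<delta> (cis (x - s))\<bar> / s) \<partial>lborel)
     \<le> ennreal e"
proof -
  have [measurable]: "\<mu> \<in> borel_measurable borel" using assms(1) by (rule borel_measurable_mono)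
  define y where "y = c + \<delta> * arccos (cos x) / pi"
  define k where "k = \<delta> / pi"
  have k: "0 < k" using assms(2) by (simp add: k_def)
  define g where "g t = ennreal ((\<mu> (y + t) - \<mu> (y - t)) / t) * indicator {0<..<\<delta>} t" for t
  have [measurable]: "g \<in> borel_measurable borel" unfolding g_def by measurable
  have "(\<integral>\<^sup>+ s \<in> {0<..<pi}. ennreal (\<bar>folded_boundary \<mu> c \<delta> (cis (x + s)) - folded_boundary \<mu> c \<delta> (cis (x - s))\<bar> / s) \<partial>lborel)
     \<le> (\<integral>\<^sup>+ s. ennreal k * g (0 + k * s) \<partial>lborel)"
  proof (rule nn_integral_mono)
    fix s :: real
    show "ennreal (\<bar>folded_boundary \<mu> c \<delta> (cis (x + s)) - folded_boundary \<mu> c \<delta> (cis (x - s))\<bar> / s) * indicator {0<..<pi} s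
       \<le> ennreal k * g (0 + k * s)"
    proof (cases "s \<in> {0<..<pi}")
      case True
      then have "k * s \<in> {0<..<\<delta>}" using assms(2) by (auto simp: k_def field_simps)
      then have "ennreal k * g (0 + k * s) = ennreal k * ennreal ((\<mu> (y + k * s) - \<mu> (y - k * s)) / (k * s))"
        by (simp add: g_def)
      also have "\<dots> = ennreal (k * ((\<mu> (y + k * s) - \<mu> (y - k * s)) / (k * s)))"
        using k by (intro ennreal_mult'[symmetric]) simp
      finally have g: "ennreal k * g (0 + k * s) = ennreal (k * ((\<mu> (y + k * s) - \<mu> (y - k * s)) / (k * s)))" .
      have "\<bar>folded_boundary \<mu> c \<delta> (cis (x + s)) - folded_boundary \<mu> c \<delta> (cis (x - s))\<bar> / s
         \<le> (\<mu> (y + \<delta> * s / pi) - \<mu> (y - \<delta> * s / pi)) / s"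
        unfolding y_def using True assms by (intro divide_right_mono folded_boundary_diff) auto
      also have "\<dots> = k * ((\<mu> (y + k * s) - \<mu> (y - k * s)) / (k * s))"
        using k True by (simp add: k_def)
      finally show ?thesis using True unfolding g by (simp add: ennreal_leI)
    qed simp
  qed
  also have "\<dots> = ennreal k * (\<integral>\<^sup>+ s. g (0 + k * s) \<partial>lborel)"
    by (rule nn_integral_cmult) measurable
  also have "\<dots> = (\<integral>\<^sup>+ t. g t \<partial>lborel)"
    using nn_integral_real_affine[of g k 0] k by simp
  also have "\<dots> \<le> ennreal e" unfolding g_def by (rule bound)
  finally show ?thesis .
qed

lemma folded_boundary_continuous:
  assumes "continuous_on {c..c + \<delta>} \<mu>" "0 \<le> \<delta>"
  shows "continuous_on (sphere 0 1) (folded_boundary \<mu> c \<delta>)"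
proof -
  have r: "Re z \<in> {-1..1}" if "z \<in> sphere 0 1" for z
    using abs_Re_le_cmod[of z] that by (auto simp: abs_le_iff)
  have ar: "c + \<delta> * arccos (Re z) / pi \<in> {c..c + \<delta>}" if "z \<in> sphere 0 1" for z
  proof -
    have "0 \<le> arccos (Re z)" "arccos (Re z) \<le> pi"
      using r[OF that] by (auto simp: arccos_lbound arccos_ubound)
    then have "\<delta> * arccos (Re z) \<le> \<delta> * pi" "0 \<le> \<delta> * arccos (Re z)"
      using assms(2) by (auto intro: mult_left_mono)
    then show ?thesis by (simp add: field_simps)
  qed
  have "continuous_on (sphere 0 1) (\<lambda>z. arccos (Re z))"
    by (rule continuous_on_arccos) (use r in \<open>auto intro!: continuous_intros\<close>)
  from continuous_on_add[OF continuous_on_const continuous_on_mult_left[OF this, of "\<delta> / pi"], of c]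
  have "continuous_on (sphere 0 1) (\<lambda>z. c + \<delta> * arccos (Re z) / pi)" by simp
  then show ?thesis
    unfolding folded_boundary_def using ar by (intro continuous_on_compose2[OF assms(1)]) auto
qed

lemma folded_boundary_bounds:
  assumes "mono \<mu>" "0 \<le> \<delta>"
  shows "\<mu> c \<le> folded_boundary \<mu> c \<delta> (cis t)" "folded_boundary \<mu> c \<delta> (cis t) \<le> \<mu> (c + \<delta>)"
proof -
  have "0 \<le> arccos (cos t)" "arccos (cos t) \<le> pi" by (auto simp: arccos_lbound arccos_ubound)
  then have "\<delta> * arccos (cos t) \<le> \<delta> * pi" "0 \<le> \<delta> * arccos (cos t)"
    using assms(2) by (auto intro: mult_left_mono)
  then have "c \<le> c + \<delta> * arccos (cos t) / pi" "c + \<delta> * arccos (cos t) / pi \<le> c + \<delta>"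
    by (simp_all add: field_simps)
  then show "\<mu> c \<le> folded_boundary \<mu> c \<delta> (cis t)" "folded_boundary \<mu> c \<delta> (cis t) \<le> \<mu> (c + \<delta>)"
    unfolding folded_boundary_def using monoD[OF assms(1)] by auto
qed

text \<open>Each half circle is mapped affinely onto \<open>[c, c + \<delta>]\<close>, with angular length \<open>\<pi>\<close> for length \<open>\<delta>\<close>.\<close>
lemma folded_boundary_pushforward:
  fixes h :: "real \<Rightarrow> ennreal"
  assumes "mono \<mu>" "0 < \<delta>" and [measurable]: "h \<in> borel_measurable borel"
  shows "(\<integral>\<^sup>+ t \<in> {0..2 * pi}. h (folded_boundary \<mu> c \<delta> (cis t)) \<partial>lborel)
     \<le> ennreal (2 * pi / \<delta>) * (\<integral>\<^sup>+ t \<in> {c..c + \<delta>}. h (\<mu> t) \<partial>lborel)"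
proof -
  have [measurable]: "\<mu> \<in> borel_measurable borel" using assms(1) by (rule borel_measurable_mono)
  define g where "g t = h (\<mu> t) * indicator {c..c + \<delta>} t" for t
  define k where "k t = g (c + \<delta> / pi * t)" for t
  have [measurable]: "g \<in> borel_measurable borel" unfolding g_def by measurable
  have [measurable]: "k \<in> borel_measurable borel" unfolding k_def by measurable
  have kI: "k t = h (\<mu> (c + \<delta> * t / pi))" if "0 \<le> t" "t \<le> pi" for t
  proof -
    have "\<delta> * t \<le> \<delta> * pi" using that assms(2) by simp
    then have "c + \<delta> / pi * t \<in> {c..c + \<delta>}" using that assms(2) by (auto simp: field_simps)
    then show ?thesis by (simp add: k_def g_def)
  qed
  have "(\<integral>\<^sup>+ t \<in> {0..2 * pi}. h (folded_boundary \<mu> c \<delta> (cis t)) \<partial>lborel) \<le> (\<integral>\<^sup>+ t. k t + k (2 * pi + (-1) * t) \<partial>lborel)"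
  proof (rule nn_integral_mono)
    fix t :: real
    consider "0 \<le> t" "t \<le> pi" | "pi < t" "t \<le> 2 * pi" | "t \<notin> {0..2 * pi}" by force
    then show "h (folded_boundary \<mu> c \<delta> (cis t)) * indicator {0..2 * pi} t \<le> k t + k (2 * pi + (-1) * t)"
    proof cases
      case 1
      then show ?thesis using kI[OF 1] by (simp add: folded_boundary_def arccos_cos)
    next
      case 2
      have "cos t = cos (2 * pi - t)" by (simp add: cos_diff)
      also have "arccos \<dots> = 2 * pi - t" using 2 by (intro arccos_cos) auto
      finally show ?thesis using kI[of "2 * pi - t"] 2 by (simp add: folded_boundary_def)
    qed simp
  qed
  also have "\<dots> = (\<integral>\<^sup>+ t. k t \<partial>lborel) + (\<integral>\<^sup>+ t. k (2 * pi + (-1) * t) \<partial>lborel)"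
    by (rule nn_integral_add) measurable
  also have "(\<integral>\<^sup>+ t. k (2 * pi + (-1) * t) \<partial>lborel) = (\<integral>\<^sup>+ t. k t \<partial>lborel)"
    using nn_integral_real_affine[of k "-1" "2 * pi"] by simp
  also have "(\<integral>\<^sup>+ t. k t \<partial>lborel) = ennreal (pi / \<delta>) * (\<integral>\<^sup>+ t. g t \<partial>lborel)"
  proof -
    have "(\<integral>\<^sup>+ t. g t \<partial>lborel) = ennreal (\<delta> / pi) * (\<integral>\<^sup>+ t. k t \<partial>lborel)"
      using nn_integral_real_affine[of g "\<delta> / pi" c] assms(2) by (simp add: k_def)
    moreover have "ennreal (pi / \<delta>) * ennreal (\<delta> / pi) = 1"
      using assms(2) by (subst ennreal_mult'[symmetric]) auto
    ultimately have "ennreal (pi / \<delta>) * (\<integral>\<^sup>+ t. g t \<partial>lborel) = 1 * (\<integral>\<^sup>+ t. k t \<partial>lborel)"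
      by (simp only: mult.assoc[symmetric])
    then show ?thesis by simp
  qed
  finally have "(\<integral>\<^sup>+ t \<in> {0..2 * pi}. h (folded_boundary \<mu> c \<delta> (cis t)) \<partial>lborel)
      \<le> 2 * (ennreal (pi / \<delta>) * (\<integral>\<^sup>+ t. g t \<partial>lborel))" by (simp only: mult_2)
  also have "\<dots> = ennreal (2 * pi / \<delta>) * (\<integral>\<^sup>+ t. g t \<partial>lborel)"
  proof -
    have "2 * ennreal (pi / \<delta>) = ennreal (2 * (pi / \<delta>))"
      by (subst ennreal_mult') (use assms(2) in auto)
    then show ?thesis by (simp only: mult.assoc[symmetric] times_divide_eq_right)
  qed
  finally show ?thesis by (simp add: g_def)
qed

text \<open>The discs \<open>f n + x\<close> have boundary heights \<open>Y n\<close> converging to the folded boundary function and horizontal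
  displacements \<open>X n\<close> of size at most \<open>2 * \<eta>\<close>, of which only this bound is used. After integration over \<open>x\<close> the
  displacement is absorbed by enlarging \<open>[x0 - \<eta>, x0 + \<eta>]\<close> to \<open>[x0 - 3 * \<eta>, x0 + 3 * \<eta>]\<close>, and the limit
  \<open>n \<rightarrow> \<infinity>\<close> concerns only the heights, where upper semicontinuity and the reverse Fatou lemma suffice.
  The margin \<open>\<kappa>\<close> leaves room for a small perturbation of the discs.\<close>
lemma horizontal_integral_bound:
  fixes \<mu> :: "real \<Rightarrow> real"
  assumes w: "nonneg_subharmonic w \<Omega>"
    and \<mu>: "mono \<mu>" "continuous_on {c..c + \<delta>} \<mu>"
    and pos: "0 < \<delta>" "0 < \<eta>" "0 < \<kappa>"
    and dini: "\<And>y. (\<integral>\<^sup>+ t \<in> {0<..<\<delta>}. ennreal ((\<mu> (y + t) - \<mu> (y - t)) / t) \<partial>lborel) \<le> ennreal \<eta>"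
    and rect: "\<And>x y. x \<in> {x0 - 3 * \<eta>..x0 + 3 * \<eta>} \<Longrightarrow> y \<in> {\<mu> c - \<kappa>..\<mu> (c + \<delta>) + \<kappa>} \<Longrightarrow> Complex x y \<in> \<Omega>"
    and vert: "\<And>x. x \<in> {x0 - 3 * \<eta>..x0 + 3 * \<eta>} \<Longrightarrow>
        (\<integral>\<^sup>+ t \<in> {c..c + \<delta>}. ennreal (w (Complex x (\<mu> t))) \<partial>lborel) \<le> 1"
  defines "m \<equiv> integral {0..2 * pi} (\<lambda>t. folded_boundary \<mu> c \<delta> (cis t)) / (2 * pi)"
  shows "(\<integral>\<^sup>+ x \<in> {x0 - \<eta>..x0 + \<eta>}. ennreal (w (Complex x m)) \<partial>lborel) \<le> ennreal (6 * \<eta> / \<delta>)"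
proof -
  note D = nonneg_subharmonicD[OF w]
  note [measurable] = nonneg_subharmonic_measurable[OF w]
  define G where "G = folded_boundary \<mu> c \<delta>"
  have cG: "continuous_on (sphere 0 1) G"
    unfolding G_def by (rule folded_boundary_continuous) (use \<mu> pos in auto)
  have Gb: "\<mu> c \<le> G (cis t)" "G (cis t) \<le> \<mu> (c + \<delta>)" for t
    unfolding G_def using folded_boundary_bounds[OF \<mu>(1)] pos by auto
  have cont_Gc: "continuous_on UNIV (\<lambda>t. G (cis t))"
    using continuous_on_boundary[OF cG] continuous_on_id by blast
  have [measurable]: "(\<lambda>t. G (cis t)) \<in> borel_measurable borel"
    by (rule borel_measurable_continuous_onI[OF cont_Gc])
  define f0 where "f0 z = \<i> * schwarz_integral G z" for z
  have f0_hol: "f0 holomorphic_on ball 0 1"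
    unfolding f0_def by (intro holomorphic_intros schwarz_integral_holomorphic cG)
  have f0_Im: "Im (f0 z) \<in> {\<mu> c..\<mu> (c + \<delta>)}" if "norm z < 1" for z
    using Re_schwarz_integral_bounds[OF cG that Gb] by (simp add: f0_def)
  have f0_Re: "\<bar>Re (f0 z)\<bar> \<le> \<eta>" if "norm z < 1" for z
  proof -
    have "\<bar>Im (schwarz_integral G (of_real (norm z) * cis (Arg z)))\<bar> \<le> \<eta> / pi"
      unfolding G_def
      by (rule Im_schwarz_integral_bound[OF cG[unfolded G_def] _ that])
         (use pos folded_boundary_dini[OF \<mu>(1) pos(1) dini] in auto)
    also have "of_real (norm z) * cis (Arg z) = z" using rcis_cmod_Arg[of z] by (simp add: rcis_def)
    also have "\<eta> / pi \<le> \<eta> / 1" using pos pi_gt3 by (intro divide_left_mono) auto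
    finally show ?thesis by (simp add: f0_def)
  qed
  have f0_0: "f0 0 = \<i> * of_real m"
    unfolding f0_def m_def G_def[symmetric] by (simp add: schwarz_integral_0[OF cG])
  define d0 where "d0 = deriv f0 0"
  have d0: "(f0 has_field_derivative d0) (at 0)"
    unfolding d0_def by (rule holomorphic_derivI[OF f0_hol]) auto
  define r where "r n = 1 - 1 / (real n + 2)" for n
  have r: "0 < r n" "r n < 1" for n by (auto simp: r_def field_simps)
  \<comment> \<open>The mean value inequality on a disc needs a nonzero derivative at the centre; if the
    derivative of \<open>f0\<close> vanishes there, a linear term tending to 0 is added.\<close>
  define e where "e n = (if d0 = 0 then min \<eta> \<kappa> / (real n + 1) else 0)" for n
  have e: "0 \<le> e n" "e n \<le> \<eta>" "e n \<le> \<kappa>" for n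
  proof -
    have "min \<eta> \<kappa> / (real n + 1) \<le> min \<eta> \<kappa> / 1" using pos by (intro divide_left_mono) auto
    then show "0 \<le> e n" "e n \<le> \<eta>" "e n \<le> \<kappa>" using pos by (auto simp: e_def)
  qed
  have e_lim: "e \<longlonglongrightarrow> 0"
  proof (cases "d0 = 0")
    case True
    have "(\<lambda>n. min \<eta> \<kappa> * (1 / (real n + 1))) \<longlonglongrightarrow> min \<eta> \<kappa> * 0"
      using LIMSEQ_inverse_real_of_nat by (intro tendsto_intros) (simp add: inverse_eq_divide add.commute)
    then show ?thesis using True by (simp add: e_def[abs_def])
  qed (simp add: e_def[abs_def])
  define f where "f n z = f0 (of_real (r n) * z) + of_real (e n) * z" for n z
  have in_ball: "of_real (r n) * z \<in> ball (0::complex) 1" if "z \<in> ball 0 (1 / r n)" for n z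
    using that r[of n] by (auto simp: norm_mult field_simps)
  have cball_r: "cball (0::complex) 1 \<subseteq> ball 0 (1 / r n)" for n
  proof
    fix z :: complex assume "z \<in> cball 0 1"
    moreover have "1 < 1 / r n" using r[of n] by simp
    ultimately show "z \<in> ball 0 (1 / r n)" by simp
  qed
  have f_hol: "f n holomorphic_on ball 0 (1 / r n)" for n
  proof -
    have "f0 \<circ> (\<lambda>z. of_real (r n) * z) holomorphic_on ball 0 (1 / r n)"
      by (rule holomorphic_on_compose_gen[OF _ f0_hol]) (use in_ball in \<open>auto intro!: holomorphic_intros\<close>)
    then show ?thesis unfolding f_def o_def by (intro holomorphic_intros)
  qed
  have f_deriv: "deriv (\<lambda>z. f n z + of_real x) 0 \<noteq> 0" for n x
  proof -
    have "(f0 has_field_derivative d0) (at (of_real (r n) * 0))" using d0 by simp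
    then have "((\<lambda>z. f0 (of_real (r n) * z)) has_field_derivative d0 * of_real (r n)) (at 0)"
      by (rule DERIV_chain2[where g = "\<lambda>z. of_real (r n) * z"]) (auto intro!: derivative_eq_intros)
    then have "((\<lambda>z. f n z + of_real x) has_field_derivative d0 * of_real (r n) + of_real (e n)) (at 0)"
      unfolding f_def by (auto intro!: derivative_eq_intros)
    then have "deriv (\<lambda>z. f n z + of_real x) 0 = d0 * of_real (r n) + of_real (e n)"
      by (rule DERIV_imp_deriv)
    moreover have "d0 * of_real (r n) + of_real (e n) \<noteq> 0"
    proof (cases "d0 = 0")
      case True
      then have "0 < e n" using pos by (simp add: e_def)
      then show ?thesis using True by simp
    next
      case False
      then show ?thesis using r(1)[of n] by (simp add: e_def)
    qed
    ultimately show ?thesis by simp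
  qed
  have f_range: "\<bar>Re (f n z)\<bar> \<le> 2 * \<eta>" "Im (f n z) \<in> {\<mu> c - \<kappa>..\<mu> (c + \<delta>) + \<kappa>}" if "norm z \<le> 1" for n z
  proof -
    have z: "norm (of_real (r n) * z) < 1" using in_ball[of z n] cball_r[of n] that by auto
    have "e n * norm z \<le> e n * 1" using that e(1)[of n] by (intro mult_left_mono) auto
    moreover have "\<bar>e n * Re z\<bar> \<le> e n * norm z" "\<bar>e n * Im z\<bar> \<le> e n * norm z"
      using e(1)[of n] abs_Re_le_cmod[of z] abs_Im_le_cmod[of z] by (auto simp: abs_mult intro!: mult_left_mono)
    ultimately have ez: "\<bar>e n * Re z\<bar> \<le> e n" "\<bar>e n * Im z\<bar> \<le> e n" by linarith+
    show "\<bar>Re (f n z)\<bar> \<le> 2 * \<eta>"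
      using f0_Re[OF z] ez e(2)[of n] by (simp add: f_def)
    have "\<bar>e n * Im z\<bar> \<le> \<kappa>" using ez(2) e(3)[of n] by linarith
    then show "Im (f n z) \<in> {\<mu> c - \<kappa>..\<mu> (c + \<delta>) + \<kappa>}"
      using f0_Im[OF z] by (auto simp: f_def abs_le_iff)
  qed
  define X Y where "X n t = Re (f n (cis t))" and "Y n t = Im (f n (cis t))" for n t
  have fc: "continuous_on UNIV (\<lambda>t. f n (cis t))" for n
    by (rule continuous_on_compose2[OF holomorphic_on_imp_continuous_on[OF f_hol]])
       (use cball_r[of n] in \<open>auto intro!: continuous_intros\<close>)
  have [measurable]: "X n \<in> borel_measurable borel" "Y n \<in> borel_measurable borel" for n
    unfolding X_def Y_def by (intro borel_measurable_continuous_onI continuous_intros fc)+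
  have XY: "\<bar>X n t\<bar> \<le> 2 * \<eta>" "Y n t \<in> {\<mu> c - \<kappa>..\<mu> (c + \<delta>) + \<kappa>}" for n t
    using f_range[of "cis t" n] by (simp_all add: X_def Y_def)
  have Y_lim: "(\<lambda>n. Y n t) \<longlonglongrightarrow> G (cis t)" for t
  proof -
    have "filterlim r (at_left 1) sequentially"
    proof (rule filterlim_at_withinI)
      have "(\<lambda>n. inverse (real (Suc (Suc n)))) \<longlonglongrightarrow> 0"
        using LIMSEQ_Suc[OF LIMSEQ_inverse_real_of_nat] .
      then have "(\<lambda>n. 1 - inverse (real (Suc (Suc n)))) \<longlonglongrightarrow> 1 - 0" by (intro tendsto_intros)
      then show "r \<longlonglongrightarrow> 1" by (simp add: r_def[abs_def] inverse_eq_divide add.commute)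
      show "\<forall>\<^sub>F n in sequentially. r n \<in> {..<1} - {1}" using r by simp
    qed
    then have "(\<lambda>n. Re (schwarz_integral G (of_real (r n) * cis t))) \<longlonglongrightarrow> G (cis t)"
      using filterlim_compose[OF tendsto_uniform_limitI[OF Re_schwarz_integral_boundary[OF cG], of t]] by simp
    then have "(\<lambda>n. Re (schwarz_integral G (of_real (r n) * cis t)) + e n * sin t) \<longlonglongrightarrow> G (cis t) + 0 * sin t"
      by (intro tendsto_intros e_lim)
    then show ?thesis by (simp add: Y_def f_def f0_def)
  qed
  define I where "I = {x0 - 3 * \<eta>..x0 + 3 * \<eta>}"
  define L where "L = (\<integral>\<^sup>+ x \<in> {x0 - \<eta>..x0 + \<eta>}. ennreal (w (Complex x m)) \<partial>lborel)"
  define U where "U n p = ennreal (w (Complex (snd p) (Y n (fst p)))) * indicator {0..2 * pi} (fst p) * indicator I (snd p)"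
    for n and p :: "real \<times> real"
  define V where "V p = ennreal (w (Complex (snd p) (G (cis (fst p))))) * indicator {0..2 * pi} (fst p) * indicator I (snd p)"
    for p :: "real \<times> real"
  have [measurable]: "I \<in> sets borel" by (simp add: I_def)
  have Um [measurable]: "U n \<in> borel_measurable (lborel \<Otimes>\<^sub>M lborel)" for n
    unfolding U_def by measurable
  have Vm [measurable]: "V \<in> borel_measurable (lborel \<Otimes>\<^sub>M lborel)"
    unfolding V_def by measurable
  \<comment> \<open>Jensen's inequality on every translate, integrated over the translations.\<close>
  have step: "ennreal (2 * pi) * L \<le> (\<integral>\<^sup>+ p. U n p \<partial>(lborel \<Otimes>\<^sub>M lborel))" for n
  proof -
    have jensen: "ennreal (2 * pi * w (Complex x m)) \<le> (\<integral>\<^sup>+ t \<in> {0..2 * pi}. ennreal (w (Complex (x + X n t) (Y n t))) \<partial>lborel)"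
      if x: "x \<in> {x0 - \<eta>..x0 + \<eta>}" for x
    proof -
      have "ennreal (2 * pi * w (f n 0 + of_real x)) \<le> (\<integral>\<^sup>+ t \<in> {0..2 * pi}. ennreal (w (f n (cis t) + of_real x)) \<partial>lborel)"
      proof (rule nonneg_subharmonic_holomorphic_disc[OF w open_ball cball_r _ _ f_deriv])
        show "(\<lambda>z. f n z + of_real x) holomorphic_on ball 0 (1 / r n)" by (intro holomorphic_intros f_hol)
        show "(\<lambda>z. f n z + of_real x) ` cball 0 1 \<subseteq> \<Omega>"
        proof clarify
          fix z :: complex assume "z \<in> cball 0 1"
          then have "norm z \<le> 1" by simp
          note fr = f_range[OF this, of n]
          have "Complex (Re (f n z) + x) (Im (f n z)) \<in> \<Omega>"
            using fr x by (intro rect) (auto simp: abs_le_iff)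
          also have "Complex (Re (f n z) + x) (Im (f n z)) = f n z + of_real x" by (simp add: complex_eq_iff)
          finally show "f n z + of_real x \<in> \<Omega>" .
        qed
      qed
      moreover have "f n 0 + of_real x = Complex x m" by (simp add: f_def f0_0 complex_eq_iff)
      moreover have "f n (cis t) + of_real x = Complex (x + X n t) (Y n t)" for t
        by (simp add: X_def Y_def complex_eq_iff)
      ultimately show ?thesis by simp
    qed
    have "ennreal (2 * pi) * L = (\<integral>\<^sup>+ x. ennreal (2 * pi) * (ennreal (w (Complex x m)) * indicator {x0 - \<eta>..x0 + \<eta>} x) \<partial>lborel)"
      unfolding L_def by (rule nn_integral_cmult[symmetric]) measurable
    also have "\<dots> \<le> (\<integral>\<^sup>+ x. \<integral>\<^sup>+ t. ennreal (w (Complex (x + X n t) (Y n t))) * indicator {0..2 * pi} t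
        * indicator {x0 - \<eta>..x0 + \<eta>} x \<partial>lborel \<partial>lborel)"
    proof (rule nn_integral_mono)
      fix x :: real
      show "ennreal (2 * pi) * (ennreal (w (Complex x m)) * indicator {x0 - \<eta>..x0 + \<eta>} x)
        \<le> (\<integral>\<^sup>+ t. ennreal (w (Complex (x + X n t) (Y n t))) * indicator {0..2 * pi} t * indicator {x0 - \<eta>..x0 + \<eta>} x \<partial>lborel)"
        using jensen[of x] by (cases "x \<in> {x0 - \<eta>..x0 + \<eta>}") (simp_all add: ennreal_mult')
    qed
    also have "\<dots> = (\<integral>\<^sup>+ t. \<integral>\<^sup>+ x. ennreal (w (Complex (x + X n t) (Y n t))) * indicator {0..2 * pi} t
        * indicator {x0 - \<eta>..x0 + \<eta>} x \<partial>lborel \<partial>lborel)"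
      by (rule lborel_pair.Fubini') measurable
    also have "\<dots> \<le> (\<integral>\<^sup>+ t. \<integral>\<^sup>+ x. U n (t, x) \<partial>lborel \<partial>lborel)"
    proof (rule nn_integral_mono)
      fix t :: real
      have "(\<integral>\<^sup>+ x. ennreal (w (Complex (x + X n t) (Y n t))) * indicator {0..2 * pi} t * indicator {x0 - \<eta>..x0 + \<eta>} x \<partial>lborel)
         \<le> (\<integral>\<^sup>+ x. U n (t, x + X n t) \<partial>lborel)"
        using XY(1)[of n t] by (intro nn_integral_mono) (auto simp: U_def I_def indicator_def abs_le_iff)
      also have "\<dots> = (\<integral>\<^sup>+ x. U n (t, x) \<partial>lborel)"
        by (rule nn_integral_lborel_shift[where F = "\<lambda>x. U n (t, x)"]) measurable
      finally show "(\<integral>\<^sup>+ x. ennreal (w (Complex (x + X n t) (Y n t))) * indicator {0..2 * pi} t * indicator {x0 - \<eta>..x0 + \<eta>} x \<partial>lborel)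
         \<le> (\<integral>\<^sup>+ x. U n (t, x) \<partial>lborel)" .
    qed
    also have "\<dots> = (\<integral>\<^sup>+ p. U n p \<partial>(lborel \<Otimes>\<^sub>M lborel))"
      by (rule lborel.nn_integral_fst[OF Um])
    finally show ?thesis .
  qed
  define R where "R = cbox (Complex (x0 - 3 * \<eta>) (\<mu> c - \<kappa>)) (Complex (x0 + 3 * \<eta>) (\<mu> (c + \<delta>) + \<kappa>))"
  have "R \<subseteq> \<Omega>"
  proof
    fix z assume "z \<in> R"
    then have "Complex (Re z) (Im z) \<in> \<Omega>" by (intro rect) (auto simp: R_def in_cbox_complex_iff)
    then show "z \<in> \<Omega>" by simp
  qed
  have inR: "Complex x (Y n t) \<in> R" if "x \<in> I" for x n t
    using that XY(2)[of n t] by (auto simp: R_def I_def in_cbox_complex_iff)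
  have "R \<noteq> {}" using inR[of x0] pos by (auto simp: I_def)
  then obtain b where b: "\<And>z. z \<in> R \<Longrightarrow> w z \<le> w b"
    using usc_on_attains_max[OF usc_on_subset[OF D(3) \<open>R \<subseteq> \<Omega>\<close>]] by (metis R_def compact_cbox)
  define W where "W p = ennreal (w b) * indicator ({0..2 * pi} \<times> I) p" for p :: "real \<times> real"
  have "ennreal (2 * pi) * L \<le> limsup (\<lambda>n. \<integral>\<^sup>+ p. U n p \<partial>(lborel \<Otimes>\<^sub>M lborel))"
    using Limsup_mono[of "\<lambda>_. ennreal (2 * pi) * L" _ sequentially] step by (simp add: Limsup_const)
  also have "\<dots> \<le> (\<integral>\<^sup>+ p. limsup (\<lambda>n. U n p) \<partial>(lborel \<Otimes>\<^sub>M lborel))"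
  proof (rule nn_integral_limsup[OF Um])
    show "W \<in> borel_measurable (lborel \<Otimes>\<^sub>M lborel)" unfolding W_def by measurable
    show "AE p in lborel \<Otimes>\<^sub>M lborel. U n p \<le> W p" for n
    proof (intro always_eventually allI)
      fix p show "U n p \<le> W p"
        using b[OF inR, of "snd p" n "fst p"] by (cases p) (auto simp: U_def W_def indicator_def intro: ennreal_leI)
    qed
    have "(\<integral>\<^sup>+ p. W p \<partial>(lborel \<Otimes>\<^sub>M lborel)) = ennreal (w b) * emeasure (lborel \<Otimes>\<^sub>M lborel) ({0..2 * pi} \<times> I)"
      unfolding W_def by (rule nn_integral_cmult_indicator) measurable
    also have "emeasure (lborel \<Otimes>\<^sub>M lborel) ({0..2 * pi} \<times> I) = emeasure lborel {0..2 * pi} * emeasure lborel I"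
      by (rule lborel.emeasure_pair_measure_Times) auto
    also have "ennreal (w b) * \<dots> < \<infinity>"
      using pos by (simp add: I_def ennreal_mult_less_top)
    finally show "(\<integral>\<^sup>+ p. W p \<partial>(lborel \<Otimes>\<^sub>M lborel)) < \<infinity>" .
  qed
  also have "\<dots> \<le> (\<integral>\<^sup>+ p. V p \<partial>(lborel \<Otimes>\<^sub>M lborel))"
  proof (rule nn_integral_mono)
    fix p :: "real \<times> real"
    obtain t x where p: "p = (t, x)" by (cases p)
    show "limsup (\<lambda>n. U n p) \<le> V p"
    proof (cases "t \<in> {0..2 * pi} \<and> x \<in> I")
      case True
      have "(\<lambda>n. Complex x (Y n t)) \<longlonglongrightarrow> Complex x (G (cis t))" by (intro tendsto_intros Y_lim)
      moreover have "Complex x (G (cis t)) \<in> \<Omega>"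
        using True Gb[of t] pos by (intro rect) (auto simp: I_def)
      ultimately have "limsup (\<lambda>n. ennreal (w (Complex x (Y n t)))) \<le> ennreal (w (Complex x (G (cis t))))"
        by (rule usc_on_limsup_le[OF D(3,1)])
      then show ?thesis using True by (simp add: U_def V_def p)
    next
      case False
      then have "U n p = 0" for n by (auto simp: U_def p)
      then show ?thesis by (simp add: Limsup_const)
    qed
  qed
  also have "\<dots> = (\<integral>\<^sup>+ x. \<integral>\<^sup>+ t. V (t, x) \<partial>lborel \<partial>lborel)"
    by (rule lborel_pair.nn_integral_snd[OF Vm, symmetric])
  also have "\<dots> \<le> (\<integral>\<^sup>+ x. ennreal (2 * pi / \<delta>) * indicator I x \<partial>lborel)"
  proof (rule nn_integral_mono)
    fix x :: real
    show "(\<integral>\<^sup>+ t. V (t, x) \<partial>lborel) \<le> ennreal (2 * pi / \<delta>) * indicator I x"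
    proof (cases "x \<in> I")
      case True
      have "(\<integral>\<^sup>+ t. V (t, x) \<partial>lborel) = (\<integral>\<^sup>+ t \<in> {0..2 * pi}. ennreal (w (Complex x (folded_boundary \<mu> c \<delta> (cis t)))) \<partial>lborel)"
        using True by (simp add: V_def G_def)
      also have "\<dots> \<le> ennreal (2 * pi / \<delta>) * (\<integral>\<^sup>+ t \<in> {c..c + \<delta>}. ennreal (w (Complex x (\<mu> t))) \<partial>lborel)"
        by (rule folded_boundary_pushforward[OF \<mu>(1) pos(1), where h = "\<lambda>y. ennreal (w (Complex x y))"]) measurable
      also have "\<dots> \<le> ennreal (2 * pi / \<delta>) * 1"
        using vert[of x] True by (intro mult_left_mono) (auto simp: I_def)
      finally show ?thesis using True by simp
    qed (simp add: V_def)
  qed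
  also have "\<dots> = ennreal (2 * pi / \<delta>) * ennreal (6 * \<eta>)"
    using pos by (subst nn_integral_cmult_indicator) (auto simp: I_def)
  also have "\<dots> = ennreal (2 * pi) * ennreal (6 * \<eta> / \<delta>)"
    using pos by (simp flip: ennreal_mult')
  finally show ?thesis
    unfolding L_def[symmetric] by (subst (asm) ennreal_mult_le_mult_iff) auto
qed

section \<open>Local bounds and compactness\<close>

lemma complex_coordinates_close:
  assumes "dist z z0 < \<rho>"
  shows "\<bar>Re z - Re z0\<bar> < \<rho>" "\<bar>Im z - Im z0\<bar> < \<rho>"
  using abs_Re_le_cmod[of "z - z0"] abs_Im_le_cmod[of "z - z0"] assms by (simp_all add: dist_norm)

text \<open>The mean depends continuously on \<open>c\<close> and lies between \<open>\<mu> c\<close> and \<open>\<mu> (c + \<delta>)\<close>. Hence at \<open>c = s - 2 * \<delta>\<close> it is at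
  most \<open>\<mu> (s - \<delta>)\<close> and at \<open>c = s + \<delta>\<close> at least \<open>\<mu> (s + \<delta>)\<close>.\<close>
lemma folded_boundary_mean_attains:
  assumes \<mu>: "mono \<mu>" "continuous_on {s - 2 * \<delta>..s + 2 * \<delta>} \<mu>" and "0 < \<delta>"
    and y: "\<mu> (s - \<delta>) \<le> y" "y \<le> \<mu> (s + \<delta>)"
  obtains c where "s - 2 * \<delta> \<le> c" "c \<le> s + \<delta>"
    "integral {0..2 * pi} (\<lambda>t. folded_boundary \<mu> c \<delta> (cis t)) / (2 * pi) = y"
proof -
  define m where "m c = integral {0..2 * pi} (\<lambda>t. folded_boundary \<mu> c \<delta> (cis t)) / (2 * pi)" for c
  define J where "J = {s - 2 * \<delta>..s + \<delta>}"
  have range: "c + \<delta> * arccos (cos t) / pi \<in> {s - 2 * \<delta>..s + 2 * \<delta>}" if "c \<in> J" for c t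
  proof -
    have "0 \<le> arccos (cos t)" "arccos (cos t) \<le> pi" by (auto simp: arccos_lbound arccos_ubound)
    then have "\<delta> * arccos (cos t) \<le> \<delta> * pi" "0 \<le> \<delta> * arccos (cos t)" using assms(3) by auto
    then have "\<delta> * arccos (cos t) / pi \<le> \<delta>" "0 \<le> \<delta> * arccos (cos t) / pi" by (simp_all add: field_simps)
    then show ?thesis using that unfolding J_def by auto
  qed
  have "continuous_on (J \<times> {0..2 * pi}) (\<lambda>p. arccos (cos (snd p)))"
    by (rule continuous_on_arccos) (auto intro!: continuous_intros)
  from continuous_on_add[OF continuous_on_fst[OF continuous_on_id] continuous_on_mult_left[OF this, of "\<delta> / pi"]]
  have inner: "continuous_on (J \<times> {0..2 * pi}) (\<lambda>p. fst p + \<delta> * arccos (cos (snd p)) / pi)" by simp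
  have joint: "continuous_on (J \<times> {0..2 * pi}) (\<lambda>(c, t). folded_boundary \<mu> c \<delta> (cis t))"
    unfolding folded_boundary_def case_prod_unfold cis.sel
    by (rule continuous_on_compose2[OF \<mu>(2) inner]) (use range in auto)
  have cont: "continuous_on J m"
    unfolding m_def using integral_continuous_on_param[of J 0 "2 * pi", OF joint[folded cbox_interval]]
    by (intro continuous_intros) (simp_all add: cbox_interval)
  have int: "(\<lambda>t. folded_boundary \<mu> c \<delta> (cis t)) integrable_on {0..2 * pi}" if "c \<in> J" for c
  proof -
    have "continuous_on {0..2 * pi} (\<lambda>t. (\<lambda>(c, t). folded_boundary \<mu> c \<delta> (cis t)) (c, t))"
      by (rule continuous_on_compose2[OF joint]) (use that in \<open>auto intro!: continuous_intros\<close>)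
    then show ?thesis by (intro integrable_continuous_real) simp
  qed
  have bounds: "\<mu> c \<le> m c" "m c \<le> \<mu> (c + \<delta>)" if "c \<in> J" for c
  proof -
    have "integral {0..2 * pi} (\<lambda>t. \<mu> c) \<le> integral {0..2 * pi} (\<lambda>t. folded_boundary \<mu> c \<delta> (cis t))"
      using folded_boundary_bounds(1)[OF \<mu>(1)] assms(3) by (intro integral_le int that) auto
    then show "\<mu> c \<le> m c" by (simp add: m_def field_simps)
    have "integral {0..2 * pi} (\<lambda>t. folded_boundary \<mu> c \<delta> (cis t)) \<le> integral {0..2 * pi} (\<lambda>t. \<mu> (c + \<delta>))"
      using folded_boundary_bounds(2)[OF \<mu>(1)] assms(3) by (intro integral_le int that) auto
    then show "m c \<le> \<mu> (c + \<delta>)" by (simp add: m_def field_simps)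
  qed
  have "m (s - 2 * \<delta>) \<le> y" using bounds(2)[of "s - 2 * \<delta>"] y(1) assms(3) by (auto simp: J_def)
  moreover have "y \<le> m (s + \<delta>)" using bounds(1)[of "s + \<delta>"] y(2) assms(3) by (auto simp: J_def)
  ultimately obtain c where "s - 2 * \<delta> \<le> c" "c \<le> s + \<delta>" "m c = y"
    using IVT'[of m "s - 2 * \<delta>" y "s + \<delta>"] cont assms(3) by (auto simp: J_def)
  then show ?thesis using that by (simp add: m_def)
qed

text \<open>With \<open>z0\<close> at height \<open>\<mu> s\<close>, the parameters are chosen in this order: \<open>\<eta>\<close> so that horizontal segments of
  length \<open>3 * \<eta>\<close> on both sides of \<open>z0\<close> stay in the square, then \<open>\<delta>\<close> so small that class A bounds the
  displacement by \<open>\<eta>\<close> and that all heights used lie strictly between -1 and 1. None of them depends on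
  \<open>w\<close>.\<close>
lemma class_A_local_bound:
  assumes \<nu>: "\<nu> \<in> class_A (-1) 1" and z0: "z0 \<in> open_square"
  obtains \<rho> C where "0 < \<rho>"
    "\<And>w z. nonneg_subharmonic w open_square \<Longrightarrow>
       (\<And>x. x \<in> {-1<..<1} \<Longrightarrow> (\<integral>\<^sup>+ y. ennreal (w (Complex x y)) \<partial>\<nu>) \<le> 1) \<Longrightarrow> z \<in> ball z0 \<rho> \<Longrightarrow> w z \<le> C"
proof -
  define \<mu> where "\<mu> = extended_inverse \<nu> (-1) 1"
  note mono = inverse_mono[OF \<nu>, folded \<mu>_def]
  have x0: "\<bar>Re z0\<bar> < 1" and y0: "-1 < Im z0" "Im z0 < 1" using z0 by (auto simp: open_square_def)
  obtain s where s: "0 < s" "s < 1" "\<mu> s = Im z0"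
    using inverse_surj[OF \<nu> y0] unfolding \<mu>_def by blast
  define \<eta> where "\<eta> = (1 - \<bar>Re z0\<bar>) / 4"
  have "4 * \<eta> = 1 - \<bar>Re z0\<bar>" by (simp add: \<eta>_def)
  then have \<eta>: "0 < \<eta>" "\<bar>Re z0\<bar> + 4 * \<eta> = 1" using x0 by linarith+
  obtain \<delta>0 where \<delta>0: "0 < \<delta>0" "\<And>\<delta> x. 0 < \<delta> \<Longrightarrow> \<delta> < \<delta>0 \<Longrightarrow>
    (\<integral>\<^sup>+ t \<in> {0<..<\<delta>}. ennreal ((\<mu> (x + t) - \<mu> (x - t)) / t) \<partial>lborel) \<le> ennreal \<eta>"
    using inverse_dini_small[OF \<nu> \<eta>(1)] unfolding \<mu>_def by blast
  define \<delta> where "\<delta> = min (\<delta>0 / 2) (min (s / 3) ((1 - s) / 3))"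
  have "\<delta> \<le> \<delta>0 / 2" "\<delta> \<le> s / 3" "\<delta> \<le> (1 - s) / 3"
    unfolding \<delta>_def by linarith+
  moreover have "0 < \<delta>" using \<delta>0(1) s by (simp add: \<delta>_def)
  moreover have "3 * ((1 - s) / 3) = 1 - s" by simp
  ultimately have \<delta>: "0 < \<delta>" "\<delta> < \<delta>0" "0 < s - 2 * \<delta>" "s + 2 * \<delta> < 1"
    using \<delta>0(1) s by linarith+
  define lo hi where "lo = \<mu> (s - \<delta>)" and "hi = \<mu> (s + \<delta>)"
  have lohi: "lo < Im z0" "Im z0 < hi"
    unfolding lo_def hi_def s(3)[symmetric] \<mu>_def by (intro inverse_strict_mono[OF \<nu>]; use \<delta> s in auto)+
  have ends: "-1 < \<mu> (s - 2 * \<delta>)" "\<mu> (s + 2 * \<delta>) < 1"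
    unfolding \<mu>_def by (intro inverse_interior[OF \<nu>]; use \<delta> s in auto)+
  define \<kappa> where "\<kappa> = min (\<mu> (s - 2 * \<delta>) + 1) (1 - \<mu> (s + 2 * \<delta>)) / 2"
  have \<kappa>: "0 < \<kappa>" "-1 < \<mu> (s - 2 * \<delta>) - \<kappa>" "\<mu> (s + 2 * \<delta>) + \<kappa> < 1"
    using ends by (auto simp: \<kappa>_def min_def field_simps)
  have cont: "continuous_on {p..q} \<mu>" if "0 \<le> p" "q \<le> 1" for p q
    using inverse_continuous[OF \<nu>] that unfolding \<mu>_def by (auto intro: continuous_on_subset)
  define \<rho> where "\<rho> = min \<eta> (min (Im z0 - lo) (hi - Im z0)) / 2"
  have \<rho>: "0 < \<rho>" "2 * \<rho> \<le> \<eta>" "2 * \<rho> \<le> Im z0 - lo" "2 * \<rho> \<le> hi - Im z0"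
    using \<eta> lohi by (auto simp: \<rho>_def)
  have lo1: "-1 < lo" and hi1: "hi < 1"
    using ends monoD[OF mono, of "s - 2 * \<delta>" "s - \<delta>"] monoD[OF mono, of "s + \<delta>" "s + 2 * \<delta>"] \<delta>
    by (auto simp: lo_def hi_def)
  show ?thesis
  proof (rule that[OF \<rho>(1)])
    fix w :: "complex \<Rightarrow> real" and z
    assume w: "nonneg_subharmonic w open_square"
      and vert: "\<And>x. x \<in> {-1<..<1} \<Longrightarrow> (\<integral>\<^sup>+ y. ennreal (w (Complex x y)) \<partial>\<nu>) \<le> 1"
      and z: "z \<in> ball z0 \<rho>"
    note [measurable] = nonneg_subharmonic_measurable[OF w]
    have hor: "(\<integral>\<^sup>+ x \<in> {Re z0 - \<eta>..Re z0 + \<eta>}. ennreal (w (Complex x y)) \<partial>lborel) \<le> ennreal (6 * \<eta> / \<delta>)"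
      if y: "lo \<le> y" "y \<le> hi" for y
    proof -
      obtain c where c: "s - 2 * \<delta> \<le> c" "c \<le> s + \<delta>"
        and m: "integral {0..2 * pi} (\<lambda>t. folded_boundary \<mu> c \<delta> (cis t)) / (2 * pi) = y"
        by (rule folded_boundary_mean_attains[OF mono cont \<delta>(1), of s y])
           (use y \<delta> in \<open>simp_all add: lo_def hi_def\<close>)
      show ?thesis
        unfolding m[symmetric]
      proof (rule horizontal_integral_bound[OF w mono cont \<delta>(1) \<eta>(1) \<kappa>(1) \<delta>0(2)[OF \<delta>(1,2)]])
        fix x assume "x \<in> {Re z0 - 3 * \<eta>..Re z0 + 3 * \<eta>}"
        then have x: "x \<in> {-1<..<1}" using \<eta> by (auto simp: abs_if split: if_splits)
        have "(\<integral>\<^sup>+ t \<in> {c..c + \<delta>}. ennreal (w (Complex x (\<mu> t))) \<partial>lborel)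
            \<le> (\<integral>\<^sup>+ t \<in> {0..1}. ennreal (w (Complex x (\<mu> t))) \<partial>lborel)"
          using c \<delta> by (intro nn_integral_mono) (auto simp: indicator_def)
        also have "\<dots> = (\<integral>\<^sup>+ y. ennreal (w (Complex x y)) \<partial>\<nu>)"
          unfolding \<mu>_def by (rule nn_integral_inverse[OF \<nu>, of "\<lambda>y. ennreal (w (Complex x y))"]) measurable
        also have "\<dots> \<le> 1" by (rule vert[OF x])
        finally show "(\<integral>\<^sup>+ t \<in> {c..c + \<delta>}. ennreal (w (Complex x (\<mu> t))) \<partial>lborel) \<le> 1" .
        fix y' assume "y' \<in> {\<mu> c - \<kappa>..\<mu> (c + \<delta>) + \<kappa>}"
        moreover have "\<mu> (s - 2 * \<delta>) \<le> \<mu> c" "\<mu> (c + \<delta>) \<le> \<mu> (s + 2 * \<delta>)"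
          using c by (auto intro!: monoD[OF mono])
        ultimately show "Complex x y' \<in> open_square"
          using x \<kappa> by (auto simp: open_square_def)
      qed (use c \<delta> in auto)
    qed
    have zc: "\<bar>Re z - Re z0\<bar> < \<rho>" "\<bar>Im z - Im z0\<bar> < \<rho>"
      using complex_coordinates_close[of z z0 \<rho>] z by (auto simp: dist_commute)
    show "w z \<le> 2 * (6 * \<eta> / \<delta>) / \<rho>"
    proof (rule nonneg_subharmonic_bound_from_horizontal[OF w _ \<rho>(1)])
      show "cball z \<rho> \<subseteq> open_square"
      proof
        fix v assume "v \<in> cball z \<rho>"
        then have "\<bar>Re v - Re z\<bar> \<le> \<rho>" "\<bar>Im v - Im z\<bar> \<le> \<rho>"
          using abs_Re_le_cmod[of "v - z"] abs_Im_le_cmod[of "v - z"] by (auto simp: dist_norm norm_minus_commute)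
        then have "\<bar>Re v\<bar> < 1" "lo < Im v" "Im v < hi" using zc \<rho> \<eta> by linarith+
        then show "v \<in> open_square" using lo1 hi1 by (auto simp: open_square_def)
      qed
      show "0 \<le> 6 * \<eta> / \<delta>" using \<eta> \<delta> by simp
      fix y assume "\<bar>y - Im z\<bar> < \<rho>"
      then have y: "lo \<le> y" "y \<le> hi" using zc \<rho> by linarith+
      have "{Re z - \<rho>..Re z + \<rho>} \<subseteq> {Re z0 - \<eta>..Re z0 + \<eta>}" using zc(1) \<rho>(2) by auto
      then have "(\<integral>\<^sup>+ x \<in> {Re z - \<rho>..Re z + \<rho>}. ennreal (w (Complex x y)) \<partial>lborel)
          \<le> (\<integral>\<^sup>+ x \<in> {Re z0 - \<eta>..Re z0 + \<eta>}. ennreal (w (Complex x y)) \<partial>lborel)"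
        by (intro nn_integral_mono) (auto simp: indicator_def)
      also note hor[OF y]
      finally show "(\<integral>\<^sup>+ x \<in> {Re z - \<rho>..Re z + \<rho>}. ennreal (w (Complex x y)) \<partial>lborel) \<le> ennreal (6 * \<eta> / \<delta>)" .
    qed
  qed
qed

theorem theorem3:
  fixes \<nu> :: "real measure" and K :: "complex set"
  assumes "\<nu> \<in> class_A (-1) 1"
    and "compact K" and "K \<subseteq> open_square"
  shows "\<exists>C::real. \<forall>u :: complex \<Rightarrow> ereal.
           subharmonic_on u open_square \<longrightarrow>
           (\<forall>x\<in>{-1<..<1}. (\<integral>\<^sup>+ y \<in> {-1<..<1}. e2ennreal (max (u (Complex x y)) 0) \<partial>\<nu>) \<le> 1) \<longrightarrow>
           (\<forall>z\<in>K. u z \<le> ereal C)"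
proof -
  define adm where "adm w \<longleftrightarrow> nonneg_subharmonic w open_square \<and>
      (\<forall>x\<in>{-1<..<1}. (\<integral>\<^sup>+ y. ennreal (w (Complex x y)) \<partial>\<nu>) \<le> 1)" for w
  have "\<exists>\<rho> C. 0 < \<rho> \<and> (\<forall>w. adm w \<longrightarrow> (\<forall>z\<in>ball z0 \<rho>. w z \<le> C))" if z0: "z0 \<in> K" for z0
  proof -
    have "z0 \<in> open_square" using z0 assms(3) by auto
    from class_A_local_bound[OF assms(1) this] show ?thesis unfolding adm_def by metis
  qed
  then obtain \<rho> C where loc: "\<And>z0. z0 \<in> K \<Longrightarrow> 0 < \<rho> z0"
    "\<And>z0 w z. z0 \<in> K \<Longrightarrow> adm w \<Longrightarrow> z \<in> ball z0 (\<rho> z0) \<Longrightarrow> w z \<le> C z0"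
    by metis
  obtain T where T: "T \<subseteq> K" "finite T" "K \<subseteq> (\<Union>z0\<in>T. ball z0 (\<rho> z0))"
    using compactE_image[OF assms(2), of K "\<lambda>z0. ball z0 (\<rho> z0)"] loc(1) by force
  define M where "M = Max (insert 0 (C ` T))"
  have M: "C z0 \<le> M" if "z0 \<in> T" for z0
    unfolding M_def using T(2) that by (intro Max_ge) auto
  show ?thesis
  proof (intro exI[of _ M] allI impI ballI)
    fix u :: "complex \<Rightarrow> ereal" and z
    assume u: "subharmonic_on u open_square"
      and vert: "\<forall>x\<in>{-1<..<1}. (\<integral>\<^sup>+ y \<in> {-1<..<1}. e2ennreal (max (u (Complex x y)) 0) \<partial>\<nu>) \<le> 1"
      and z: "z \<in> K"
    define w where "w = pos_part u open_square"
    have "adm w"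
      unfolding adm_def
    proof (intro conjI ballI)
      show "nonneg_subharmonic w open_square" unfolding w_def by (rule pos_part_nonneg_subharmonic[OF u])
      fix x :: real assume x: "x \<in> {-1<..<1}"
      have "(\<integral>\<^sup>+ y. ennreal (w (Complex x y)) \<partial>\<nu>) = (\<integral>\<^sup>+ y \<in> {-1<..<1}. e2ennreal (max (u (Complex x y)) 0) \<partial>\<nu>)"
      proof (rule nn_integral_cong)
        fix y :: real
        show "ennreal (w (Complex x y)) = e2ennreal (max (u (Complex x y)) 0) * indicator {-1<..<1} y"
        proof (cases "y \<in> {-1<..<1}")
          case True
          then have "Complex x y \<in> open_square" using x by (auto simp: open_square_def)
          then show ?thesis using pos_part_eq(2)[OF u] True by (simp add: w_def)
        next
          case False
          then have "Complex x y \<notin> open_square" by (auto simp: open_square_def)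
          then show ?thesis using False by (simp add: w_def pos_part_def)
        qed
      qed
      then show "(\<integral>\<^sup>+ y. ennreal (w (Complex x y)) \<partial>\<nu>) \<le> 1" using vert x by simp
    qed
    obtain z0 where z0: "z0 \<in> T" "z \<in> ball z0 (\<rho> z0)" using T(3) z by auto
    have "w z \<le> C z0" using loc(2)[of z0 w z] \<open>adm w\<close> z0 T(1) by auto
    also have "\<dots> \<le> M" by (rule M[OF z0(1)])
    finally have "ereal (w z) \<le> ereal M" by simp
    moreover have "u z \<le> ereal (w z)"
      unfolding w_def using pos_part_eq(1)[OF u, of z] z assms(3) by auto
    ultimately show "u z \<le> ereal M" by (rule order_trans[rotated])
  qed
qed

end
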